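(* Let $R$ be a unital associative superalgebra over $\Bbbk$ and $n\geqslant 3$. Then the second homology (with trivial coefficients $\Bbbk$) of the special queer Lie superalgebra satisfies $\mathrm{H}_2(\mathfrak{sq}_n(R))\cong\mathrm{HC}_1(R)\otimes\Bbbk^{0|1}$.
   Context: $\Bbbk$ is a unital commutative associative ring in which $2$ is invertible; $|x|$ denotes parity. $\mathfrak{gl}_{n|n}(R)$ is the Lie superalgebra of $2n\times 2n$ matrices over $R$ with matrix unit $e_{ij}(a)$ of parity $|i|+|j|+|a|$ ($|i|=0$ for $i\leqslant n$, $|i|=1$ for $i>n$) and bracket $[X,Y]=XY-(-1)^{|X||Y|}YX$. For homogeneous $a\in R$, $\rho(a)=(-1)^{|a|}a$ (extended linearly), applied entrywise to matrices. $\mathfrak{q}_n(R)=\left\{\begin{pmatrix}A&B\\\rho(B)&\rho(A)\end{pmatrix}: A,B\in \mathrm{M}_n(R)\right\}\subseteq\mathfrak{gl}_{n|n}(R)$ and $\mathfrak{sq}_n(R)=[\mathfrak{q}_n(R),\mathfrak{q}_n(R)]$. Let $I_R\subseteq R\otimes R$ be the $\Bbbk$-submodule generated by $a\otimes b+(-1)^{|a||b|}b\otimes a$ and $(-1)^{|a||c|}ab\otimes c+(-1)^{|b||a|}bc\otimes a+(-1)^{|c||b|}ca\otimes b$ for homogeneous $a,b,c\in R$, $\langle R,R\rangle=(R\otimes R)/I_R$ with $\boldsymbol{\lambda}(a,b)$ the image of $a\otimes b$, and $\mathrm{HC}_1(R)=\{\sum_i\boldsymbol{\lambda}(a_i,b_i):\sum_i(a_ib_i-(-1)^{|a_i||b_i|}b_ia_i)=0\}$.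 $\Bbbk^{0|1}$ is the graded module with zero even part and odd part $\Bbbk$, so $M\otimes\Bbbk^{0|1}$ is $M$ with parity reversed. *)

theory Defs
  imports Main "HOL-Library.Function_Algebras"
begin

text \<open>Parities are booleans: False = even, True = odd.
  ssign p q x = (-1)^(p q) x.\<close>
definition ssign :: "bool \<Rightarrow> bool \<Rightarrow> 'a::ab_group_add \<Rightarrow> 'a" where
  "ssign p q x = (if p \<and> q then - x else x)"

definition hom :: "'m set \<Rightarrow> 'm set \<Rightarrow> bool \<Rightarrow> 'm \<Rightarrow> bool" where
  "hom E Od p a = (if p then a \<in> Od else a \<in> E)"

definition proj :: "'m::ab_group_add set \<Rightarrow> 'm set \<Rightarrow> bool \<Rightarrow> 'm \<Rightarrow> 'm" where
  "proj E Od p a = (THE b. hom E Od p b \<and> hom E Od (\<not> p) (a - b))"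

inductive_set kspan :: "('k \<Rightarrow> 'm \<Rightarrow> 'm) \<Rightarrow> 'm set \<Rightarrow> 'm::ab_group_add set"
  for sc :: "'k \<Rightarrow> 'm \<Rightarrow> 'm" and G :: "'m set" where
  zero: "0 \<in> kspan sc G"
| gen: "g \<in> G \<Longrightarrow> g \<in> kspan sc G"
| add: "x \<in> kspan sc G \<Longrightarrow> y \<in> kspan sc G \<Longrightarrow> x + y \<in> kspan sc G"
| smul: "x \<in> kspan sc G \<Longrightarrow> sc r x \<in> kspan sc G"

definition scomm :: "'m set \<Rightarrow> 'm set \<Rightarrow> ('m \<Rightarrow> 'm \<Rightarrow> 'm) \<Rightarrow> 'm \<Rightarrow> 'm \<Rightarrow> 'm::ab_group_add" where
  "scomm E Od mul a b =
     (\<Sum>p\<in>UNIV. \<Sum>q\<in>UNIV. mul (proj E Od p a) (proj E Od q b)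
                           - ssign p q (mul (proj E Od q b) (proj E Od p a)))"

definition superalgebra :: "('k::comm_ring_1 \<Rightarrow> 'r::ring \<Rightarrow> 'r) \<Rightarrow> 'r \<Rightarrow> 'r set \<Rightarrow> 'r set \<Rightarrow> bool" where
  "superalgebra sc e R0 R1 \<longleftrightarrow>
     (\<forall>a b x. sc a (sc b x) = sc (a * b) x) \<and> (\<forall>x. sc 1 x = x)
   \<and> (\<forall>a x y. sc a (x + y) = sc a x + sc a y) \<and> (\<forall>a b x. sc (a + b) x = sc a x + sc b x)
   \<and> (\<forall>r a b. sc r (a * b) = sc r a * b \<and> sc r (a * b) = a * sc r b)
   \<and> (\<forall>a. e * a = a \<and> a * e = a)
   \<and> (\<forall>S\<in>{R0, R1}. 0 \<in> S \<and> (\<forall>a\<in>S. \<forall>b\<in>S. a + b \<in> S) \<and> (\<forall>r. \<forall>a\<in>S. sc r a \<in> S))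
   \<and> R0 \<inter> R1 = {0}
   \<and> (\<forall>a. \<exists>x\<in>R0. \<exists>y\<in>R1. a = x + y)
   \<and> e \<in> R0
   \<and> (\<forall>p q a b. hom R0 R1 p a \<longrightarrow> hom R0 R1 q b \<longrightarrow> hom R0 R1 (p \<noteq> q) (a * b))"

definition fsc :: "'k::comm_ring_1 \<Rightarrow> ('x \<Rightarrow> 'k) \<Rightarrow> ('x \<Rightarrow> 'k)" where
  "fsc r f = (\<lambda>i. r * f i)"

definition tns :: "'m \<Rightarrow> 'm \<Rightarrow> ('m \<times> 'm \<Rightarrow> 'k::comm_ring_1)" where
  "tns a b = (\<lambda>x. if x = (a, b) then 1 else 0)"

definition pairs_mod :: "'m set \<Rightarrow> ('m \<times> 'm \<Rightarrow> 'k::comm_ring_1) set" where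
  "pairs_mod C = kspan fsc {tns a b | a b. a \<in> C \<and> b \<in> C}"

definition pairs_deg :: "'m set \<Rightarrow> 'm set \<Rightarrow> 'm set \<Rightarrow> bool \<Rightarrow> ('m \<times> 'm \<Rightarrow> 'k::comm_ring_1) set" where
  "pairs_deg C E Od p = kspan fsc {tns a b | a b q s.
      a \<in> C \<and> b \<in> C \<and> hom E Od q a \<and> hom E Od s b \<and> p = (q \<noteq> s)}"

text \<open>Relations making the free module into the tensor product C (x)_k C.\<close>
definition bilin_rels :: "'m::ab_group_add set \<Rightarrow> ('k::comm_ring_1 \<Rightarrow> 'm \<Rightarrow> 'm) \<Rightarrow> ('m \<times> 'm \<Rightarrow> 'k) set" where
  "bilin_rels C sc =
     {tns (a + b) c - tns a c - tns b c | a b c. a \<in> C \<and> b \<in> C \<and> c \<in> C}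
   \<union> {tns a (b + c) - tns a b - tns a c | a b c. a \<in> C \<and> b \<in> C \<and> c \<in> C}
   \<union> {tns (sc r a) b - fsc r (tns a b) | r a b. a \<in> C \<and> b \<in> C}
   \<union> {tns a (sc r b) - fsc r (tns a b) | r a b. a \<in> C \<and> b \<in> C}"

definition cyc_rels :: "'m set \<Rightarrow> 'm set \<Rightarrow> 'm set \<Rightarrow> ('m \<Rightarrow> 'm \<Rightarrow> 'm) \<Rightarrow> ('m \<times> 'm \<Rightarrow> 'k::comm_ring_1) set" where
  "cyc_rels C E Od mul =
     {tns a b + fsc (ssign p q 1) (tns b a) | a b p q.
        a \<in> C \<and> b \<in> C \<and> hom E Od p a \<and> hom E Od q b}
   \<union> {fsc (ssign p s 1) (tns (mul a b) c) + fsc (ssign q p 1) (tns (mul b c) a)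
        + fsc (ssign s q 1) (tns (mul c a) b) | a b c p q s.
        a \<in> C \<and> b \<in> C \<and> c \<in> C \<and> hom E Od p a \<and> hom E Od q b \<and> hom E Od s c}"

text \<open>Submodule of the free module whose quotient is <C,C>.\<close>
definition lam_rels :: "'m::ab_group_add set \<Rightarrow> ('k::comm_ring_1 \<Rightarrow> 'm \<Rightarrow> 'm) \<Rightarrow> 'm set \<Rightarrow> 'm set
      \<Rightarrow> ('m \<Rightarrow> 'm \<Rightarrow> 'm) \<Rightarrow> ('m \<times> 'm \<Rightarrow> 'k) set" where
  "lam_rels C sc E Od mul = kspan fsc (bilin_rels C sc \<union> cyc_rels C E Od mul)"

definition lin_ext :: "('k \<Rightarrow> 'n \<Rightarrow> 'n) \<Rightarrow> ('m \<Rightarrow> 'm \<Rightarrow> 'n::ab_group_add) \<Rightarrow> ('m \<times> 'm \<Rightarrow> 'k::zero) \<Rightarrow> 'n" where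
  "lin_ext sc \<phi> t = (\<Sum>x\<in>{x. t x \<noteq> 0}. sc (t x) (\<phi> (fst x) (snd x)))"

text \<open>Representatives of the kernel of  lambda(a,b) |-> phi a b.\<close>
definition cycle_set :: "'m set \<Rightarrow> ('k \<Rightarrow> 'n \<Rightarrow> 'n) \<Rightarrow> ('m \<Rightarrow> 'm \<Rightarrow> 'n::ab_group_add)
      \<Rightarrow> ('m \<times> 'm \<Rightarrow> 'k::comm_ring_1) set" where
  "cycle_set C sc \<phi> = {t \<in> pairs_mod C. lin_ext sc \<phi> t = 0}"

text \<open>Z1/J1 and Z2/J2 (J_i \<subseteq> Z_i), graded by the classes of D1 p, D2 p.
  An isomorphism of k-modules Z1/J1 \<cong> Z2/J2 given on representatives by f,
  sending parity p to parity (not p), i.e.  Z1/J1 \<cong> (Z2/J2) (x) k^(0|1).\<close>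
definition graded_iso_shift :: "('x \<Rightarrow> 'k::comm_ring_1) set \<Rightarrow> ('x \<Rightarrow> 'k) set \<Rightarrow> (bool \<Rightarrow> ('x \<Rightarrow> 'k) set)
      \<Rightarrow> ('y \<Rightarrow> 'k) set \<Rightarrow> ('y \<Rightarrow> 'k) set \<Rightarrow> (bool \<Rightarrow> ('y \<Rightarrow> 'k) set) \<Rightarrow> bool" where
  "graded_iso_shift Z1 J1 D1 Z2 J2 D2 \<longleftrightarrow>
    (\<exists>f. (\<forall>x\<in>Z1. f x \<in> Z2)
       \<and> (\<forall>x\<in>Z1. \<forall>y\<in>Z1. f (x + y) - f x - f y \<in> J2)
       \<and> (\<forall>r. \<forall>x\<in>Z1. f (fsc r x) - fsc r (f x) \<in> J2)
       \<and> (\<forall>x\<in>Z1. \<forall>y\<in>Z1. f x - f y \<in> J2 \<longleftrightarrow> x - y \<in> J1)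
       \<and> (\<forall>z\<in>Z2. \<exists>x\<in>Z1. f x - z \<in> J2)
       \<and> (\<forall>p. \<forall>x\<in>Z1. (\<exists>d\<in>D1 p. x - d \<in> J1) \<longrightarrow> (\<exists>d\<in>D2 (\<not> p). f x - d \<in> J2)))"

text \<open>A 2n x 2n matrix is a function nat => nat => 'r vanishing outside
  indices 0..2n-1; index i is odd iff n <= i.\<close>
type_synonym 'r mat = "nat \<Rightarrow> nat \<Rightarrow> 'r"

definition ipar :: "nat \<Rightarrow> nat \<Rightarrow> bool" where
  "ipar n i = (n \<le> i)"

definition gl_car :: "nat \<Rightarrow> ('r::zero) mat set" where
  "gl_car n = {X. \<forall>i j. (2 * n \<le> i \<or> 2 * n \<le> j) \<longrightarrow> X i j = 0}"

definition mat_hom :: "'r set \<Rightarrow> 'r set \<Rightarrow> nat \<Rightarrow> bool \<Rightarrow> 'r mat set" where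
  "mat_hom R0 R1 n p = {X. \<forall>i j. hom R0 R1 (p \<noteq> (ipar n i \<noteq> ipar n j)) (X i j)}"

definition mmul :: "nat \<Rightarrow> ('r::semiring_0) mat \<Rightarrow> 'r mat \<Rightarrow> 'r mat" where
  "mmul n X Y = (\<lambda>i j. \<Sum>k<2 * n. X i k * Y k j)"

definition msc :: "('k \<Rightarrow> 'r \<Rightarrow> 'r) \<Rightarrow> 'k \<Rightarrow> 'r mat \<Rightarrow> 'r mat" where
  "msc sc r X = (\<lambda>i j. sc r (X i j))"

definition rho :: "'r::ab_group_add set \<Rightarrow> 'r set \<Rightarrow> 'r \<Rightarrow> 'r" where
  "rho R0 R1 a = proj R0 R1 False a - proj R0 R1 True a"

definition q_car :: "'r::ab_group_add set \<Rightarrow> 'r set \<Rightarrow> nat \<Rightarrow> 'r mat set" where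
  "q_car R0 R1 n = {X \<in> gl_car n. \<forall>i<n. \<forall>j<n.
       X (i + n) (j + n) = rho R0 R1 (X i j) \<and> X (i + n) j = rho R0 R1 (X i (j + n))}"

definition gl_bracket :: "'r::ring set \<Rightarrow> 'r set \<Rightarrow> nat \<Rightarrow> 'r mat \<Rightarrow> 'r mat \<Rightarrow> 'r mat" where
  "gl_bracket R0 R1 n = scomm (mat_hom R0 R1 n False) (mat_hom R0 R1 n True) (mmul n)"

definition sq_car :: "('k \<Rightarrow> 'r \<Rightarrow> 'r) \<Rightarrow> 'r::ring set \<Rightarrow> 'r set \<Rightarrow> nat \<Rightarrow> 'r mat set" where
  "sq_car sc R0 R1 n = kspan (msc sc) {gl_bracket R0 R1 n X Y | X Y p q.
       X \<in> q_car R0 R1 n \<and> Y \<in> q_car R0 R1 n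
     \<and> X \<in> mat_hom R0 R1 n p \<and> Y \<in> mat_hom R0 R1 n q}"

text \<open>H_2(L) with trivial coefficients = ker (d_2: Lambda^2 L / im d_3 -> L),
  where Lambda^2 L / im d_3 is L (x) L modulo super-antisymmetry and the
  (cyclic form of the) image of d_3, i.e. the module <L,L> for the bracket.\<close>
definition H2_cycles :: "('k::comm_ring_1 \<Rightarrow> 'r::ring \<Rightarrow> 'r) \<Rightarrow> 'r set \<Rightarrow> 'r set \<Rightarrow> nat \<Rightarrow> ('r mat \<times> 'r mat \<Rightarrow> 'k) set" where
  "H2_cycles sc R0 R1 n = cycle_set (sq_car sc R0 R1 n) (msc sc) (gl_bracket R0 R1 n)"

definition H2_rels :: "('k::comm_ring_1 \<Rightarrow> 'r::ring \<Rightarrow> 'r) \<Rightarrow> 'r set \<Rightarrow> 'r set \<Rightarrow> nat \<Rightarrow> ('r mat \<times> 'r mat \<Rightarrow> 'k) set" where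
  "H2_rels sc R0 R1 n = lam_rels (sq_car sc R0 R1 n) (msc sc)
      (sq_car sc R0 R1 n \<inter> mat_hom R0 R1 n False) (sq_car sc R0 R1 n \<inter> mat_hom R0 R1 n True)
      (gl_bracket R0 R1 n)"

definition H2_deg :: "('k::comm_ring_1 \<Rightarrow> 'r::ring \<Rightarrow> 'r) \<Rightarrow> 'r set \<Rightarrow> 'r set \<Rightarrow> nat \<Rightarrow> bool \<Rightarrow> ('r mat \<times> 'r mat \<Rightarrow> 'k) set" where
  "H2_deg sc R0 R1 n = pairs_deg (sq_car sc R0 R1 n)
      (sq_car sc R0 R1 n \<inter> mat_hom R0 R1 n False) (sq_car sc R0 R1 n \<inter> mat_hom R0 R1 n True)"

definition HC1_cycles :: "('k::comm_ring_1 \<Rightarrow> 'r::ring \<Rightarrow> 'r) \<Rightarrow> 'r set \<Rightarrow> 'r set \<Rightarrow> ('r \<times> 'r \<Rightarrow> 'k) set" where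
  "HC1_cycles sc R0 R1 = cycle_set UNIV sc (scomm R0 R1 (*))"

definition HC1_rels :: "('k::comm_ring_1 \<Rightarrow> 'r::ring \<Rightarrow> 'r) \<Rightarrow> 'r set \<Rightarrow> 'r set \<Rightarrow> ('r \<times> 'r \<Rightarrow> 'k) set" where
  "HC1_rels sc R0 R1 = lam_rels UNIV sc R0 R1 (*)"

definition HC1_deg :: "('k::comm_ring_1 \<Rightarrow> 'r::ring \<Rightarrow> 'r) \<Rightarrow> 'r set \<Rightarrow> 'r set \<Rightarrow> bool \<Rightarrow> ('r \<times> 'r \<Rightarrow> 'k) set" where
  "HC1_deg sc R0 R1 = pairs_deg UNIV R0 R1"

end

theory Submission
  imports Complex_Main Defs "HOL-Library.Product_Plus"
begin

text \<open>Adjoin to $R$ an odd $\omega$ with $\omega^2 = 1$ and $\omega a = \rho(a)\omega$, giving $S$; then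
  $\mathfrak{q}_n(R) = \mathfrak{gl}_n(S)$. The map to cyclic homology sends $X \otimes Y$ to the
  $\omega$-component of the trace of $XY$, with products in $R$ replaced by $\lambda$.
  Conversely, since $[\omega, \omega] = 2$ is invertible, the derived algebra contains the whole torus
  $e_{ii}(1)$, and a weight argument disposes of every class outside weight zero. In weight zero the Jacobi identity on $e_{ij}, e_{jk}, e_{ki}$ shows that
  $\ell(s,t) = \{e_{10}(s), e_{01}(t)\} - \{e_{10}(st), e_{01}(1)\}$ is a cyclic form on $S$.
  Such a form is determined by the commutator except on pairs $(a, b\omega)$, where it is a
  cyclic form on $R$ inverse to the trace map; indices are counted from zero.\<close>

section \<open>Characters\<close>

\<comment> \<open>The characters take values in Q/Z, which is divisible, so that partial characters
  extend, and has elements of every finite order, so that they can be made nonzero at a prescribed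
  element. The price is that they are only additive: Q/Z has no action of the ground ring and
  contains 2-torsion. This shapes everything after it. Linearity of a form over the scalars becomes
  the rule that a scalar may move from one argument to the other, and every division by 2 is carried
  out on an argument, by \<open>sc u\<close>, before the character is applied. The core statement is
  that every form satisfying the relations of H_2 is an additive function of the bracket plus a
  trace form. The additive function disappears on cycles, so it may be chosen freely.\<close>
quotient_type rat_circle = rat / "\<lambda>x y. x - y \<in> \<int>"
proof (rule equivpI)
  show "reflp (\<lambda>x y::rat. x - y \<in> \<int>)" by (simp add: reflp_def)
  show "symp (\<lambda>x y::rat. x - y \<in> \<int>)"
    by (rule sympI) (metis Ints_minus minus_diff_eq)
  show "transp (\<lambda>x y::rat. x - y \<in> \<int>)"
  proof (rule transpI)
    fix x y z :: rat assume "x - y \<in> \<int>" "y - z \<in> \<int>"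
    from Ints_add[OF this] show "x - z \<in> \<int>" by simp
  qed
qed

instantiation rat_circle :: ab_group_add
begin

lift_definition zero_rat_circle :: rat_circle is 0 .
lift_definition plus_rat_circle :: "rat_circle \<Rightarrow> rat_circle \<Rightarrow> rat_circle" is "(+)"
  by (simp add: add_diff_add)
lift_definition minus_rat_circle :: "rat_circle \<Rightarrow> rat_circle \<Rightarrow> rat_circle" is "(-)"
  by (metis Ints_diff diff_diff_eq2 diff_add_eq diff_diff_eq add.commute)
lift_definition uminus_rat_circle :: "rat_circle \<Rightarrow> rat_circle" is uminus
  by (metis Ints_minus minus_diff_minus)

instance
  by standard (transfer; simp add: algebra_simps)+

end

section \<open>Divisibility and torsion of Q/Z\<close>

lift_definition circle_mult :: "int \<Rightarrow> rat_circle \<Rightarrow> rat_circle" is "\<lambda>m x. of_int m * x"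
  by (metis Ints_mult Ints_of_int right_diff_distrib)

lemma circle_mult_simps:
  "circle_mult 0 d = 0" "circle_mult 1 d = d"
  "circle_mult (a + b) d = circle_mult a d + circle_mult b d"
  "circle_mult m (c + d) = circle_mult m c + circle_mult m d"
  "circle_mult a (circle_mult b d) = circle_mult (a * b) d"
  "circle_mult m 0 = 0"
  by (transfer; simp add: algebra_simps)+

lemma circle_divisible:
  assumes "m \<noteq> 0" shows "\<exists>d. circle_mult m d = c"
  using assms
  by (transfer) (metis Ints_0 diff_self nonzero_mult_div_cancel_left of_int_eq_0_iff times_divide_eq_right)

text \<open>Supplies the value at an element whose order modulo a subgroup is m: 1/m works for m
  \<ge> 2. The value m = 0 codes infinite order, where any nonzero value such as 1/2 is allowed, and
  m = 1 would put the element into the subgroup.\<close>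

lemma circle_torsion_point:
  assumes "m \<noteq> 1" "0 \<le> m" shows "\<exists>d. d \<noteq> 0 \<and> circle_mult m d = 0"
proof (cases "m = 0")
  case True
  have "\<exists>d::rat_circle. d \<noteq> 0"
  proof transfer
    have "(1/2::rat) \<notin> \<int>"
    proof
      assume "(1/2::rat) \<in> \<int>"
      then obtain k where "(1/2::rat) = of_int k" by (auto elim: Ints_cases)
      then have "(of_int (2 * k)::rat) = of_int 1" by simp
      then have "2 * k = 1" by (simp only: of_int_eq_iff)
      then show False by presburger
    qed
    then show "\<exists>d::rat. d - 0 \<notin> \<int>" by (intro exI[of _ "1/2"]) simp
  qed
  then show ?thesis using True by (auto simp: circle_mult_simps)
next
  case False
  then have m: "m \<ge> 2" using assms by simp
  have "(1 / of_int m::rat) \<notin> \<int>"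
  proof
    assume "(1 / of_int m::rat) \<in> \<int>"
    then obtain k where "(1 / of_int m::rat) = of_int k" by (auto elim: Ints_cases)
    then have "(of_int (m * k)::rat) = of_int 1" using m by (simp add: field_simps)
    then have "m * k = 1" by (simp only: of_int_eq_iff)
    then show False using m by (simp add: zmult_eq_1_iff)
  qed
  moreover have "of_int m * (1 / of_int m::rat) = 1" using m by simp
  ultimately show ?thesis
    by transfer (metis Ints_1 diff_zero)
qed


text \<open>A homomorphism from a subgroup to the circle is represented by its graph.\<close>

definition partial_character ::
    "('a::comm_ring_1 \<Rightarrow> 'b::ab_group_add \<Rightarrow> 'b) \<Rightarrow> ('b \<times> rat_circle) set \<Rightarrow> bool" where
  "partial_character scale G \<longleftrightarrow> 0 \<in> G \<and> (\<forall>x\<in>G. \<forall>y\<in>G. x + y \<in> G)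
     \<and> (\<forall>m. \<forall>(w, c)\<in>G. (scale (of_int m) w, circle_mult m c) \<in> G)
     \<and> (\<forall>d. (0, d) \<in> G \<longrightarrow> d = 0)"

context module
begin

lemma partial_characterD:
  fixes G :: "('b \<times> rat_circle) set" and w w' :: 'b
  assumes "partial_character scale G"
  shows "(0, 0) \<in> G" "(w, c) \<in> G \<Longrightarrow> (w', c') \<in> G \<Longrightarrow> (w + w', c + c') \<in> G"
    "(w, c) \<in> G \<Longrightarrow> (scale (of_int m) w, circle_mult m c) \<in> G"
    "(0, d) \<in> G \<Longrightarrow> d = 0"
proof -
  show "(0, 0) \<in> G" "(0, d) \<in> G \<Longrightarrow> d = 0"
    using assms by (auto simp: partial_character_def zero_prod_def)
  show "(w + w', c + c') \<in> G" if "(w, c) \<in> G" "(w', c') \<in> G"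
    using assms that unfolding partial_character_def by (metis add_Pair)
  show "(scale (of_int m) w, circle_mult m c) \<in> G" if "(w, c) \<in> G"
    using assms that unfolding partial_character_def by blast
qed

lemma partial_character_unique:
  assumes "partial_character scale G" "(w, c) \<in> G" "(w, c') \<in> G"
  shows "c = c'"
proof -
  have "(scale (of_int (-1)) w, circle_mult (-1) c') \<in> G"
    using partial_characterD(3)[OF assms(1,3)] .
  moreover have "circle_mult (-1) c' + c' = 0"
    using circle_mult_simps(3)[of "-1" 1 c'] by (simp add: circle_mult_simps)
  then have "circle_mult (-1) c' = - c'" by (simp add: eq_neg_iff_add_eq_0)
  ultimately have "(0, c - c') \<in> G"
    using partial_characterD(2)[OF assms(1) assms(2), of "- w" "- c'"] by simp
  then show ?thesis using partial_characterD(4)[OF assms(1)] by force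
qed

text \<open>The condition on \<open>d\<close> says that it agrees with the values already taken on
  multiples of \<open>v\<close>. Adding the cyclic group generated by \<open>(v, d)\<close> to the
  graph then creates no second value at 0.\<close>

lemma partial_character_extend:
  assumes G: "partial_character scale G"
    and d: "\<And>m c. (scale (of_int m) v, c) \<in> G \<Longrightarrow> c = circle_mult m d"
  shows "\<exists>G'. partial_character scale G' \<and> G \<subseteq> G' \<and> (v, d) \<in> G'"
proof (intro exI conjI)
  define G' where "G' = {(w + scale (of_int m) v, c + circle_mult m d) | w c m. (w, c) \<in> G}"
  show "partial_character scale G'"
    unfolding partial_character_def
  proof (intro conjI allI ballI impI)
    show "0 \<in> G'"
      unfolding G'_def zero_prod_def using partial_characterD(1)[OF G]
      by (intro CollectI exI[of _ 0]) (auto simp: circle_mult_simps)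
  next
    fix x y assume "x \<in> G'" "y \<in> G'"
    then obtain w c m w' c' m' where *: "x = (w + scale (of_int m) v, c + circle_mult m d)"
      "y = (w' + scale (of_int m') v, c' + circle_mult m' d)" "(w, c) \<in> G" "(w', c') \<in> G"
      unfolding G'_def by blast
    have "x + y = ((w + w') + scale (of_int (m + m')) v, (c + c') + circle_mult (m + m') d)"
      by (simp add: * circle_mult_simps scale_left_distrib algebra_simps)
    then show "x + y \<in> G'" unfolding G'_def using partial_characterD(2)[OF G *(3,4)] by blast
  next
    fix m x assume "x \<in> G'"
    then obtain w c k where *: "x = (w + scale (of_int k) v, c + circle_mult k d)" "(w, c) \<in> G"
      unfolding G'_def by blast
    have "(scale (of_int m) w + scale (of_int (m * k)) v, circle_mult m c + circle_mult (m * k) d) \<in> G'"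
      unfolding G'_def using partial_characterD(3)[OF G *(2)] by blast
    then show "case x of (w, c) \<Rightarrow> (scale (of_int m) w, circle_mult m c) \<in> G'"
      by (simp add: * circle_mult_simps scale_right_distrib)
  next
    fix c0 assume "(0, c0) \<in> G'"
    then obtain w c k where *: "0 = w + scale (of_int k) v" "c0 = c + circle_mult k d" "(w, c) \<in> G"
      unfolding G'_def by blast
    have "w = scale (of_int (- k)) v" using *(1) by (simp add: eq_neg_iff_add_eq_0)
    then have "c = circle_mult (- k) d" using d *(3) by blast
    then show "c0 = 0"
      using *(2) circle_mult_simps(3)[of "- k" k d] by (simp add: circle_mult_simps)
  qed
  show "G \<subseteq> G'"
  proof
    fix x assume "x \<in> G"
    then show "x \<in> G'" unfolding G'_def
      by (intro CollectI exI[of _ "fst x"] exI[of _ "snd x"] exI[of _ 0])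
        (auto simp: circle_mult_simps)
  qed
  show "(v, d) \<in> G'" unfolding G'_def using partial_characterD(1)[OF G]
    by (intro CollectI exI[of _ 0] exI[of _ 1]) (auto simp: circle_mult_simps)
qed

text \<open>Ideals of the integers are principal. Applied to the integers m for which m times a
  given vector lies in a subgroup, it reduces compatibility on all such multiples to a single
  one.\<close>

lemma multiples_generator:
  fixes I :: "int set"
  assumes "0 \<in> I" "\<And>a b. a \<in> I \<Longrightarrow> b \<in> I \<Longrightarrow> a + b \<in> I" "\<And>a m. a \<in> I \<Longrightarrow> m * a \<in> I"
  shows "\<exists>g\<in>I. 0 \<le> g \<and> (\<forall>a\<in>I. g dvd a)"
proof (cases "\<exists>a\<in>I. a \<noteq> 0")
  case False
  then show ?thesis using assms(1) by (intro bexI[of _ 0]) auto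
next
  case True
  then obtain a where a: "a \<in> I" "a \<noteq> 0" by blast
  have "\<exists>k::nat. 0 < k \<and> int k \<in> I"
    using a assms(3)[OF a(1), of "-1"] by (intro exI[of _ "nat \<bar>a\<bar>"]) (cases "a < 0"; simp)
  then obtain k :: nat where k: "0 < k" "int k \<in> I" and min: "\<And>j. 0 < j \<Longrightarrow> int j \<in> I \<Longrightarrow> k \<le> j"
    using LeastI_ex[of "\<lambda>k. 0 < k \<and> int k \<in> I"] Least_le[of "\<lambda>k. 0 < k \<and> int k \<in> I"] by blast
  have "int k dvd b" if b: "b \<in> I" for b
  proof -
    have "b mod int k = b + (- (b div int k)) * int k"
      by (simp add: minus_div_mult_eq_mod[symmetric])
    then have "b mod int k \<in> I" using assms(2)[OF b assms(3)[OF k(2), of "- (b div int k)"]] by simp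
    moreover have "0 \<le> b mod int k" "b mod int k < int k" using k by auto
    ultimately have "b mod int k = 0" using min[of "nat (b mod int k)"] by (cases "b mod int k = 0") auto
    then show ?thesis by auto
  qed
  then show ?thesis using k by (intro bexI[of _ "int k"]) auto
qed

text \<open>Baer's argument for the injectivity of Q/Z: start from zero on \<open>J\<close>,
  prescribe a nonzero value at \<open>x\<close>, and take a maximal extension by Zorn's lemma.
  Divisibility forces the domain of a maximal extension to be everything.\<close>

theorem character_separates:
  assumes J: "subspace J" and x: "x \<notin> J"
  shows "\<exists>\<chi> :: 'b \<Rightarrow> rat_circle. (\<forall>v w. \<chi> (v + w) = \<chi> v + \<chi> w) \<and> (\<forall>v\<in>J. \<chi> v = 0) \<and> \<chi> x \<noteq> 0"
proof -
  define G0 where "G0 = J \<times> {0::rat_circle}"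
  have G0: "partial_character scale G0"
    unfolding partial_character_def G0_def zero_prod_def
    using J by (auto simp: subspace_def circle_mult_simps)
  \<comment> \<open>\<open>m0\<close> is the order of \<open>x\<close> modulo \<open>J\<close>, with
    0 standing for infinite order.\<close>
  obtain m0 where m0: "scale (of_int m0) x \<in> J" "0 \<le> m0" "\<And>m. scale (of_int m) x \<in> J \<Longrightarrow> m0 dvd m"
    using multiples_generator[of "{m. scale (of_int m) x \<in> J}"] subspace_0[OF J]
      subspace_add[OF J] subspace_scale[OF J]
    by (auto simp: scale_left_distrib) (metis scale_scale)
  have "m0 \<noteq> 1" using m0(1) x by auto
  then obtain d0 where d0: "d0 \<noteq> 0" "circle_mult m0 d0 = 0" using circle_torsion_point m0(2) by blast
  have "c = circle_mult m d0" if "(scale (of_int m) x, c) \<in> G0" for m c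
  proof -
    have "m0 dvd m" using m0(3)[of m] that by (simp add: G0_def)
    then obtain k where "m = k * m0" by (metis dvd_def mult.commute)
    then have "circle_mult m d0 = 0"
      using d0(2) by (metis circle_mult_simps(5,6))
    then show ?thesis using that by (simp add: G0_def)
  qed
  then obtain G1 where G1: "partial_character scale G1" "G0 \<subseteq> G1" "(x, d0) \<in> G1"
    using partial_character_extend[OF G0] by blast
  define A where "A = {G. partial_character scale G \<and> G1 \<subseteq> G}"
  have "\<exists>M\<in>A. \<forall>X\<in>A. M \<subseteq> X \<longrightarrow> X = M"
  proof (rule subset_Zorn_nonempty)
    show "A \<noteq> {}" using G1 A_def by blast
    fix \<C> assume C: "\<C> \<noteq> {}" "subset.chain A \<C>"
    have two: "\<exists>G\<in>\<C>. a \<in> G \<and> b \<in> G" if ab: "a \<in> \<Union>\<C>" "b \<in> \<Union>\<C>" for a b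
    proof -
      obtain G H where "G \<in> \<C>" "a \<in> G" "H \<in> \<C>" "b \<in> H" using ab by blast
      moreover from this have "G \<subseteq> H \<or> H \<subseteq> G" using C(2) unfolding subset_chain_def by blast
      ultimately show ?thesis by blast
    qed
    have pc: "partial_character scale G" if "G \<in> \<C>" for G using C that unfolding subset_chain_def A_def by blast
    have "partial_character scale (\<Union>\<C>)"
      unfolding partial_character_def
    proof (intro conjI allI ballI impI)
      show "0 \<in> \<Union>\<C>" using C(1) pc unfolding partial_character_def by blast
    next
      fix a b assume "a \<in> \<Union>\<C>" "b \<in> \<Union>\<C>"
      then show "a + b \<in> \<Union>\<C>" using two[of a b] pc unfolding partial_character_def by blast
    next
      fix m a assume "a \<in> \<Union>\<C>"
      then show "case a of (w, c) \<Rightarrow> (scale (of_int m) w, circle_mult m c) \<in> \<Union>\<C>"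
        using partial_characterD(3)[OF pc] by (cases a) blast
    next
      fix d assume "(0, d) \<in> \<Union>\<C>"
      then show "d = 0" using partial_characterD(4)[OF pc] by blast
    qed
    then show "\<Union>\<C> \<in> A" using C unfolding A_def subset_chain_def by blast
  qed
  then obtain M where "M \<in> A" and max': "\<And>X. X \<in> A \<Longrightarrow> M \<subseteq> X \<Longrightarrow> X = M" by blast
  then have M: "partial_character scale M" "G1 \<subseteq> M"
    and max: "\<And>X. partial_character scale X \<Longrightarrow> M \<subseteq> X \<Longrightarrow> X = M"
    unfolding A_def by auto
  have total: "\<exists>c. (v, c) \<in> M" for v
  proof -
    define I where "I = {m. \<exists>c. (scale (of_int m) v, c) \<in> M}"
    have "\<exists>g\<in>I. 0 \<le> g \<and> (\<forall>a\<in>I. g dvd a)"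
    proof (rule multiples_generator)
      show "0 \<in> I" unfolding I_def using partial_characterD(1)[OF M(1)] by auto
      show "a + b \<in> I" if "a \<in> I" "b \<in> I" for a b
        using that partial_characterD(2)[OF M(1)] unfolding I_def by (fastforce simp: scale_left_distrib)
      show "m * a \<in> I" if "a \<in> I" for a m
        using that partial_characterD(3)[OF M(1), where m = m] unfolding I_def by fastforce
    qed
    then obtain g where g: "g \<in> I" "\<And>a. a \<in> I \<Longrightarrow> g dvd a" by blast
    then obtain c0 where c0: "(scale (of_int g) v, c0) \<in> M" unfolding I_def by blast
    \<comment> \<open>The multiples of \<open>v\<close> in the domain are generated by g times
      \<open>v\<close>, with value \<open>c0\<close>, so a compatible value at \<open>v\<close> is
      any g-th part of \<open>c0\<close>. For g = 0 the vector g times \<open>v\<close> is 0, which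
      forces \<open>c0\<close> to be 0.\<close>
    obtain d where d: "circle_mult g d = c0"
    proof (cases "g = 0")
      case True
      then have "c0 = 0" using c0 partial_characterD(4)[OF M(1)] by simp
      then show ?thesis using that True by (metis circle_mult_simps(1))
    qed (use circle_divisible that in blast)
    have "c = circle_mult m d" if c: "(scale (of_int m) v, c) \<in> M" for m c
    proof -
      have "g dvd m" using g(2)[of m] c unfolding I_def by blast
      then obtain k where k: "m = k * g" by (metis dvd_def mult.commute)
      have "(scale (of_int m) v, circle_mult k c0) \<in> M"
        using partial_characterD(3)[OF M(1) c0, of k] by (simp add: k)
      then show ?thesis
        using partial_character_unique[OF M(1) c] d k circle_mult_simps(5) by metis
    qed
    then show ?thesis using partial_character_extend[OF M(1)] max by metis
  qed
  define \<chi> where "\<chi> v = (THE c. (v, c) \<in> M)" for v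
  have chi: "\<chi> v = c" if "(v, c) \<in> M" for v c
    unfolding \<chi>_def using partial_character_unique[OF M(1)] that by blast
  have "\<chi> (v + w) = \<chi> v + \<chi> w" for v w
    using total[of v] total[of w] chi partial_characterD(2)[OF M(1)] by metis
  moreover have "\<chi> v = 0" if "v \<in> J" for v
    using that G1(2) M(2) by (intro chi) (auto simp: G0_def)
  moreover have "\<chi> x \<noteq> 0" using chi G1(3) M(2) d0(1) by blast
  ultimately show ?thesis by blast
qed

end

section \<open>Free modules and linear extension\<close>

text \<open>A quotient by a submodule that depends on parameters is not a type. Characters stand in for it:
  their values on the generators of a free module satisfy the relations as equations in an abelian group.\<close>

lemma (in module) mem_by_characters:
  assumes "subspace J"
    and "\<And>\<chi> :: 'b \<Rightarrow> rat_circle. additive \<chi> \<Longrightarrow> (\<And>v. v \<in> J \<Longrightarrow> \<chi> v = 0) \<Longrightarrow> \<chi> x = 0"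
  shows "x \<in> J"
  using character_separates[OF assms(1), of x] assms(2) unfolding additive_def by blast

lemma (in module) subspace_kspan: "subspace (kspan scale G)"
  unfolding subspace_def by (auto intro: kspan.intros)

lemma (in module) kspan_minimal:
  assumes "subspace H" "G \<subseteq> H" shows "kspan scale G \<subseteq> H"
proof
  fix x assume "x \<in> kspan scale G"
  then show "x \<in> H"
    by induction (use assms in \<open>auto simp: subspace_def\<close>)
qed

lemma module_fsc: "module (fsc :: 'k::comm_ring_1 \<Rightarrow> ('x \<Rightarrow> 'k) \<Rightarrow> _)"
  by standard (auto simp: fsc_def fun_eq_iff algebra_simps)

interpretation fsc: module "fsc :: 'k::comm_ring_1 \<Rightarrow> ('x \<Rightarrow> 'k) \<Rightarrow> _"
  by (rule module_fsc)

text \<open>\<open>lin_ext\<close> sums over the support, and a sum over an infinite set is 0 by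
  convention, so \<open>lin_ext\<close> is additive only where supports are finite.\<close>

definition finsup :: "('x \<Rightarrow> 'k::comm_ring_1) set" where
  "finsup = {t. finite {x. t x \<noteq> 0}}"

lemma subspace_finsup: "fsc.subspace (finsup :: ('x \<Rightarrow> 'k::comm_ring_1) set)"
  unfolding fsc.subspace_def
proof (intro conjI ballI allI)
  fix s t :: "'x \<Rightarrow> 'k" assume "s \<in> finsup" "t \<in> finsup"
  then have "finite ({x. s x \<noteq> 0} \<union> {x. t x \<noteq> 0})" by (simp add: finsup_def)
  then have "finite {x. (s + t) x \<noteq> 0}" by (rule finite_subset[rotated]) auto
  then show "s + t \<in> finsup" by (simp add: finsup_def)
next
  fix c :: 'k and t :: "'x \<Rightarrow> 'k" assume "t \<in> finsup"
  moreover have "{x. fsc c t x \<noteq> 0} \<subseteq> {x. t x \<noteq> 0}" by (auto simp: fsc_def)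
  ultimately show "fsc c t \<in> finsup" unfolding finsup_def using finite_subset by blast
qed (simp add: finsup_def)

lemma tns_finsup: "tns a b \<in> finsup"
  unfolding finsup_def tns_def
  by (rule CollectI, rule finite_subset[of _ "{(a, b)}"]) auto

lemmas finsup_closed [simp] = tns_finsup fsc.subspace_0[OF subspace_finsup]
  fsc.subspace_add[OF subspace_finsup] fsc.subspace_diff[OF subspace_finsup]
  fsc.subspace_neg[OF subspace_finsup]
  fsc.subspace_scale[OF subspace_finsup] fsc.subspace_sum[OF subspace_finsup]

lemma pairs_mod_finsup: "pairs_mod C \<subseteq> finsup"
  unfolding pairs_mod_def by (rule fsc.kspan_minimal) (auto simp: subspace_finsup)

lemma lam_rels_finsup: "lam_rels C sc E Od mul \<subseteq> finsup"
  unfolding lam_rels_def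
  by (rule fsc.kspan_minimal) (auto simp: subspace_finsup bilin_rels_def cyc_rels_def)

context module
begin

lemma lin_ext_superset:
  assumes "finite A" "{x. t x \<noteq> 0} \<subseteq> A"
  shows "lin_ext scale \<phi> t = (\<Sum>x\<in>A. scale (t x) (\<phi> (fst x) (snd x)))"
  unfolding lin_ext_def by (rule sum.mono_neutral_left) (use assms in auto)

lemma lin_ext_add:
  assumes "s \<in> finsup" "t \<in> finsup"
  shows "lin_ext scale \<phi> (s + t) = lin_ext scale \<phi> s + lin_ext scale \<phi> t"
proof -
  let ?A = "{x. s x \<noteq> 0} \<union> {x. t x \<noteq> 0}"
  have fin: "finite ?A" using assms by (simp add: finsup_def)
  have "lin_ext scale \<phi> u = (\<Sum>x\<in>?A. scale (u x) (\<phi> (fst x) (snd x)))" if "u \<in> {s, t, s + t}" for u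
    by (rule lin_ext_superset[OF fin]) (use that in auto)
  then show ?thesis by (simp add: sum.distrib[symmetric] scale_left_distrib)
qed

lemma lin_ext_fsc:
  assumes "t \<in> finsup"
  shows "lin_ext scale \<phi> (fsc c t) = scale c (lin_ext scale \<phi> t)"
proof -
  have "lin_ext scale \<phi> (fsc c t) = (\<Sum>x\<in>{x. t x \<noteq> 0}. scale (fsc c t x) (\<phi> (fst x) (snd x)))"
    by (rule lin_ext_superset) (use assms in \<open>auto simp: finsup_def fsc_def\<close>)
  then show ?thesis by (simp add: lin_ext_def fsc_def scale_sum_right)
qed

lemma lin_ext_tns: "lin_ext scale \<phi> (tns a b) = \<phi> a b"
proof -
  have "lin_ext scale \<phi> (tns a b) = (\<Sum>x\<in>{(a, b)}. scale (tns a b x) (\<phi> (fst x) (snd x)))"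
    by (rule lin_ext_superset) (auto simp: tns_def)
  then show ?thesis by (simp add: tns_def)
qed

lemma lin_ext_0: "lin_ext scale \<phi> 0 = 0"
  by (simp add: lin_ext_def)

lemma lin_ext_diff:
  assumes "s \<in> finsup" "t \<in> finsup"
  shows "lin_ext scale \<phi> (s - t) = lin_ext scale \<phi> s - lin_ext scale \<phi> t"
  using lin_ext_add[of "s - t" t \<phi>] assms by simp

lemma lin_ext_minus:
  assumes "t \<in> finsup"
  shows "lin_ext scale \<phi> (- t) = - lin_ext scale \<phi> t"
  using lin_ext_diff[of 0 t \<phi>] assms by (simp add: lin_ext_0)

lemma lin_ext_sum:
  assumes "\<And>i. i \<in> A \<Longrightarrow> f i \<in> finsup"
  shows "lin_ext scale \<phi> (\<Sum>i\<in>A. f i) = (\<Sum>i\<in>A. lin_ext scale \<phi> (f i))"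
  using assms by (induction A rule: infinite_finite_induct) (auto simp: lin_ext_0 lin_ext_add)

lemma lin_ext_kspan:
  assumes "subspace H" "G \<subseteq> finsup" "\<And>g. g \<in> G \<Longrightarrow> lin_ext scale \<phi> g \<in> H" "t \<in> kspan fsc G"
  shows "lin_ext scale \<phi> t \<in> H"
proof -
  have "fsc.subspace {t \<in> finsup. lin_ext scale \<phi> t \<in> H}"
    unfolding fsc.subspace_def
    using assms(1) by (auto simp: lin_ext_0 lin_ext_add lin_ext_fsc subspace_def)
  then show ?thesis using fsc.kspan_minimal[of _ G] assms by blast
qed

end

section \<open>Graded groups\<close>

lemma ssign_simps [simp]:
  "ssign False q x = x" "ssign p False x = x" "ssign True True x = - x"
  "ssign p q 0 = 0" "ssign p q (- x) = - ssign p q x"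
  "ssign p q (ssign p q x) = x"
  by (auto simp: ssign_def)

lemma ssign_diff: "ssign p q (x - y) = ssign p q x - ssign p q y"
  by (auto simp: ssign_def)

lemma ssign_sum: "ssign p q (\<Sum>i\<in>A. f i) = (\<Sum>i\<in>A. ssign p q (f i))"
  by (auto simp: ssign_def sum_negf)

lemma fsc_ssign: "fsc (ssign p q 1) t = ssign p q t"
  by (auto simp: ssign_def)

text \<open>Scalars are left out so that the ring with its product and the matrices with theirs are
  both instances.\<close>

locale graded =
  fixes E Od :: "'m::ab_group_add set"
  assumes zero_mem: "0 \<in> E" "0 \<in> Od"
    and add_mem: "a \<in> E \<Longrightarrow> b \<in> E \<Longrightarrow> a + b \<in> E" "a \<in> Od \<Longrightarrow> b \<in> Od \<Longrightarrow> a + b \<in> Od"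
    and uminus_mem: "a \<in> E \<Longrightarrow> - a \<in> E" "a \<in> Od \<Longrightarrow> - a \<in> Od"
    and disjoint: "E \<inter> Od = {0}"
    and decomposes: "\<exists>x\<in>E. \<exists>y\<in>Od. a = x + y"
begin

lemma hom_0 [simp]: "hom E Od p 0"
  and hom_add [intro]: "hom E Od p a \<Longrightarrow> hom E Od p b \<Longrightarrow> hom E Od p (a + b)"
  and hom_uminus [intro]: "hom E Od p a \<Longrightarrow> hom E Od p (- a)"
  using zero_mem add_mem uminus_mem by (auto simp: hom_def split: if_splits)

lemma hom_diff [intro]: "hom E Od p a \<Longrightarrow> hom E Od p b \<Longrightarrow> hom E Od p (a - b)"
  using hom_add[of p a "- b"] hom_uminus by simp

lemma hom_ssign [intro]: "hom E Od p a \<Longrightarrow> hom E Od p (ssign q r a)"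
  by (auto simp: ssign_def)

lemma hom_sum: "(\<And>i. i \<in> A \<Longrightarrow> hom E Od p (f i)) \<Longrightarrow> hom E Od p (\<Sum>i\<in>A. f i)"
  by (induction A rule: infinite_finite_induct) auto

lemma hom_disjoint: "hom E Od p a \<Longrightarrow> hom E Od (\<not> p) a \<Longrightarrow> a = 0"
  using disjoint by (auto simp: hom_def split: if_splits)

lemma hom_decomp: "\<exists>b c. hom E Od p b \<and> hom E Od (\<not> p) c \<and> a = b + c"
proof -
  obtain x y where "x \<in> E" "y \<in> Od" "a = x + y" using decomposes by blast
  then show ?thesis
    by (intro exI[of _ "if p then y else x"] exI[of _ "if p then x else y"])
      (simp add: hom_def add.commute)
qed

lemma proj_eqI:
  assumes "hom E Od p b" "hom E Od (\<not> p) (a - b)"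
  shows "proj E Od p a = b"
  unfolding proj_def
proof (rule the_equality)
  fix c assume c: "hom E Od p c \<and> hom E Od (\<not> p) (a - c)"
  have "hom E Od p (c - b)" using assms c by blast
  moreover have "hom E Od (\<not> p) ((a - b) - (a - c))" using assms c by blast
  ultimately show "c = b" using hom_disjoint[of p "c - b"] by (simp add: algebra_simps)
qed (use assms in simp)

lemma proj_spec: "hom E Od p (proj E Od p a)" "hom E Od (\<not> p) (a - proj E Od p a)"
proof -
  obtain b c where bc: "hom E Od p b" "hom E Od (\<not> p) c" "a = b + c" using hom_decomp by blast
  then have "proj E Od p a = b" by (intro proj_eqI) auto
  then show "hom E Od p (proj E Od p a)" "hom E Od (\<not> p) (a - proj E Od p a)" using bc by auto
qed

lemma proj_add: "proj E Od p (a + b) = proj E Od p a + proj E Od p b"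
  using hom_add[OF proj_spec(2)[of p a] proj_spec(2)[of p b]]
  by (intro proj_eqI hom_add proj_spec) (simp add: algebra_simps)

lemma proj_hom: "hom E Od p a \<Longrightarrow> proj E Od q a = (if p = q then a else 0)"
  by (cases "p = q") (auto intro!: proj_eqI)

lemma proj_0 [simp]: "proj E Od p 0 = 0"
  by (intro proj_eqI) auto

lemma proj_sum: "proj E Od False a + proj E Od True a = a"
  using proj_spec(2)[of False a] proj_eqI[of True "a - proj E Od False a" a] proj_spec(1)[of False a]
  by simp

text \<open>An element is the sum of its two projections. Additive statements can therefore be
  checked on homogeneous elements, where all signs are constants.\<close>

lemma hom_induct [consumes 0, case_names hom add]:
  assumes "\<And>p a. hom E Od p a \<Longrightarrow> P a" "\<And>a b. P a \<Longrightarrow> P b \<Longrightarrow> P (a + b)"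
  shows "P a"
  using assms(2)[OF assms(1)[OF proj_spec(1)] assms(1)[OF proj_spec(1)], of False a True a]
  by (simp add: proj_sum)

end

locale graded_mul = graded E Od for E Od :: "'m::ab_group_add set" +
  fixes mul :: "'m \<Rightarrow> 'm \<Rightarrow> 'm"
  assumes mul_add_left: "mul (a + b) c = mul a c + mul b c"
    and mul_add_right: "mul a (b + c) = mul a b + mul a c"
begin

lemma mul_0 [simp]: "mul 0 a = 0" "mul a 0 = 0"
  using mul_add_left[of 0 0 a] mul_add_right[of a 0 0] by auto

lemma scomm_hom:
  assumes "hom E Od p a" "hom E Od q b"
  shows "scomm E Od mul a b = mul a b - ssign p q (mul b a)"
  by (cases p; cases q; simp add: scomm_def UNIV_bool proj_hom[OF assms(1)] proj_hom[OF assms(2)])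

lemma scomm_add_left: "scomm E Od mul (a + b) c = scomm E Od mul a c + scomm E Od mul b c"
  by (simp add: scomm_def UNIV_bool proj_add mul_add_left mul_add_right)

lemma scomm_add_right: "scomm E Od mul a (b + c) = scomm E Od mul a b + scomm E Od mul a c"
  by (simp add: scomm_def UNIV_bool proj_add mul_add_left mul_add_right)

end

section \<open>Superalgebras\<close>

locale superalg =
  fixes sc :: "'k::comm_ring_1 \<Rightarrow> 'r::ring \<Rightarrow> 'r" and e :: 'r and R0 R1 :: "'r set"
  assumes SA: "superalgebra sc e R0 R1"
begin

sublocale R: module sc
  using SA by unfold_locales (simp_all add: superalgebra_def)

lemma sc_mult: "sc r (a * b) = sc r a * b" "sc r (a * b) = a * sc r b"
  using SA unfolding superalgebra_def by metis+

lemma e_mult [simp]: "e * a = a" "a * e = a"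
  using SA by (simp_all add: superalgebra_def)

abbreviation "rhom \<equiv> hom R0 R1"

lemma rhom_e [simp]: "rhom False e"
  using SA by (simp add: superalgebra_def hom_def)

lemma rhom_mult: "rhom p a \<Longrightarrow> rhom q b \<Longrightarrow> rhom (p \<noteq> q) (a * b)"
  using SA by (simp add: superalgebra_def)

lemma rhom_sc: "rhom p a \<Longrightarrow> rhom p (sc r a)"
  using SA by (auto simp: superalgebra_def hom_def)

sublocale R: graded_mul R0 R1 "(*)"
proof unfold_locales
  show "- a \<in> R0" if "a \<in> R0" for a
    using SA that R.scale_minus_left[of 1 a] unfolding superalgebra_def by (metis insertI1)
  show "- a \<in> R1" if "a \<in> R1" for a
    using SA that R.scale_minus_left[of 1 a] unfolding superalgebra_def by (metis insertI1 insertI2)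
qed (use SA in \<open>auto simp: superalgebra_def algebra_simps\<close>)

abbreviation "\<rho> \<equiv> rho R0 R1"

lemma rho_hom: "rhom p a \<Longrightarrow> \<rho> a = ssign p True a"
  by (cases p) (simp_all add: rho_def R.proj_hom)

lemma rho_add [simp]: "\<rho> (a + b) = \<rho> a + \<rho> b"
  by (simp add: rho_def R.proj_add)

lemma rho_0 [simp]: "\<rho> 0 = 0"
  using rho_add[of 0 0] by simp

lemma rho_uminus [simp]: "\<rho> (- a) = - \<rho> a"
  using rho_add[of a "- a"] by (simp add: eq_neg_iff_add_eq_0 add.commute)

lemma rho_diff [simp]: "\<rho> (a - b) = \<rho> a - \<rho> b"
  using rho_add[of a "- b"] by simp

lemma rho_sum: "\<rho> (\<Sum>i\<in>A. f i) = (\<Sum>i\<in>A. \<rho> (f i))"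
  by (induction A rule: infinite_finite_induct) auto

lemma rho_e [simp]: "\<rho> e = e"
  using rho_hom[of False e] by simp

lemma rho_rho [simp]: "\<rho> (\<rho> a) = a"
proof (induction a rule: R.hom_induct)
  case (hom p a)
  then show ?case by (cases p) (simp_all add: rho_hom)
qed simp

lemma rho_mult [simp]: "\<rho> (a * b) = \<rho> a * \<rho> b"
proof (induction a rule: R.hom_induct)
  case a: (hom p a)
  show ?case
  proof (induction b rule: R.hom_induct)
    case (hom q b)
    show ?case using rhom_mult[OF a hom]
      by (cases p; cases q; simp add: rho_hom[OF a] rho_hom[OF hom] rho_hom)
  qed (simp add: algebra_simps)
qed (simp add: algebra_simps)

lemma rho_sc [simp]: "\<rho> (sc r a) = sc r (\<rho> a)"
proof (induction a rule: R.hom_induct)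
  case (hom p a)
  then show ?case using rhom_sc[OF hom, of r] by (cases p) (simp_all add: rho_hom)
qed (simp add: R.scale_right_distrib)

lemma rhom_rho: "rhom p a \<Longrightarrow> rhom p (\<rho> a)"
  by (simp add: rho_hom R.hom_ssign)

subsection \<open>Adjoining a square root of one\<close>

text \<open>The pair $(a, b)$ stands for $a + b\omega$ in $S = R \otimes Q_1$, where $\omega$ is odd,
  $\omega^2 = 1$ and $\omega a = \rho(a)\omega$. The block matrices of $\mathfrak{q}_n(R)$ are then
  the $n \times n$ matrices over $S$.\<close>

definition smul :: "'r \<times> 'r \<Rightarrow> 'r \<times> 'r \<Rightarrow> 'r \<times> 'r" (infixl "\<bullet>" 70) where
  "s \<bullet> t = (fst s * fst t + snd s * \<rho> (snd t), fst s * snd t + snd s * \<rho> (fst t))"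

definition ssc :: "'k \<Rightarrow> 'r \<times> 'r \<Rightarrow> 'r \<times> 'r" where
  "ssc r s = (sc r (fst s), sc r (snd s))"

text \<open>\<omega> is odd, so its coefficient in an element of parity \<open>p\<close> has the
  opposite parity.\<close>

definition shom :: "bool \<Rightarrow> 'r \<times> 'r \<Rightarrow> bool" where
  "shom p s \<longleftrightarrow> rhom p (fst s) \<and> rhom (\<not> p) (snd s)"

abbreviation sone :: "'r \<times> 'r" ("\<one>") where "\<one> \<equiv> (e, 0)"

lemma smul_add: "(s + t) \<bullet> u = s \<bullet> u + t \<bullet> u" "s \<bullet> (t + u) = s \<bullet> t + s \<bullet> u"
  by (simp_all add: smul_def prod_eq_iff algebra_simps)

lemma smul_0 [simp]: "0 \<bullet> s = 0" "s \<bullet> 0 = 0"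
  by (simp_all add: smul_def prod_eq_iff)

lemma smul_uminus [simp]: "(- s) \<bullet> t = - (s \<bullet> t)" "s \<bullet> (- t) = - (s \<bullet> t)"
  by (simp_all add: smul_def prod_eq_iff)

lemma smul_assoc: "s \<bullet> t \<bullet> u = s \<bullet> (t \<bullet> u)"
  by (simp add: smul_def prod_eq_iff algebra_simps)

lemma smul_pairs: "(a, 0) \<bullet> (b, 0) = (a * b, 0)" "(a, 0) \<bullet> (0, b) = (0, a * b)"
  "(0, a) \<bullet> (b, 0) = (0, a * \<rho> b)" "(0, a) \<bullet> (0, b) = (a * \<rho> b, 0)"
  by (simp_all add: smul_def)

lemma smul_one [simp]: "\<one> \<bullet> s = s" "s \<bullet> \<one> = s"
  by (simp_all add: smul_def)

lemma smul_ssc: "ssc r s \<bullet> t = ssc r (s \<bullet> t)" "s \<bullet> ssc r t = ssc r (s \<bullet> t)"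
  by (simp_all add: smul_def ssc_def R.scale_right_distrib flip: sc_mult)

lemma shom_simps [simp]: "shom p 0" "shom False \<one>"
  by (simp_all add: shom_def)

lemma shom_ssc: "shom p s \<Longrightarrow> shom p (ssc c s)"
  by (auto simp: shom_def ssign_def ssc_def rhom_sc)

lemma shom_smul: "shom p s \<Longrightarrow> shom q t \<Longrightarrow> shom (p \<noteq> q) (s \<bullet> t)"
  using rhom_mult[of p "fst s" q "fst t"] rhom_mult[of p "fst s" "\<not> q" "snd t"]
    rhom_mult[of "\<not> p" "snd s" q "\<rho> (fst t)"] rhom_mult[of "\<not> p" "snd s" "\<not> q" "\<rho> (snd t)"]
  by (cases p; cases q) (auto simp: shom_def smul_def rhom_rho)

lemma shom_pair: "rhom p a \<Longrightarrow> shom p (a, 0)" "rhom p a \<Longrightarrow> shom (\<not> p) (0, a)"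
  by (auto simp: shom_def)

end

section \<open>The queer Lie superalgebra as matrices over $S$\<close>

lemma sum_lessThan_double: "(\<Sum>k<2 * n. f k) = (\<Sum>k<n. f k + f (k + n))"
  for f :: "nat \<Rightarrow> 'a::comm_monoid_add"
proof -
  have eq: "{..<2 * n} = {..<n} \<union> (\<lambda>k. k + n) ` {..<n}"
  proof (intro equalityI subsetI)
    fix x assume "x \<in> {..<2 * n}"
    then show "x \<in> {..<n} \<union> (\<lambda>k. k + n) ` {..<n}"
      by (cases "x < n") (auto intro!: image_eqI[of _ _ "x - n"])
  qed auto
  have "(\<Sum>k<2 * n. f k) = (\<Sum>k<n. f k) + (\<Sum>k\<in>(\<lambda>k. k + n) ` {..<n}. f k)"
    unfolding eq by (rule sum.union_disjoint) auto
  also have "(\<Sum>k\<in>(\<lambda>k. k + n) ` {..<n}. f k) = (\<Sum>k<n. f (k + n))"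
    by (subst sum.reindex) (auto simp: inj_on_def)
  finally show ?thesis by (simp add: sum.distrib)
qed

locale queer = superalg sc e R0 R1
  for sc :: "'k::comm_ring_1 \<Rightarrow> 'r::ring \<Rightarrow> 'r" and e :: 'r and R0 R1 :: "'r set" +
  fixes n :: nat and u :: 'k
  assumes n3: "3 \<le> n" and half: "2 * u = 1"
begin

sublocale M: module "msc sc"
  by standard (auto simp: msc_def fun_eq_iff R.scale_right_distrib R.scale_left_distrib)

abbreviation "mhom \<equiv> mat_hom R0 R1 n"

lemma hom_mhom [simp]: "hom (mhom False) (mhom True) p X \<longleftrightarrow> X \<in> mhom p"
  by (simp add: hom_def)

sublocale M: graded_mul "mhom False" "mhom True" "mmul n"
proof unfold_locales
  show "mhom False \<inter> mhom True = {0}"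
  proof (intro equalityI subsetI)
    fix X assume "X \<in> mhom False \<inter> mhom True"
    then have "X i j = 0" for i j
      using R.hom_disjoint[of "ipar n i \<noteq> ipar n j" "X i j"] by (auto simp: mat_hom_def)
    then show "X \<in> {0}" by (auto simp: fun_eq_iff)
  qed (auto simp: mat_hom_def)
  fix X :: "'r mat"
  define Y where "Y p = (\<lambda>i j. proj R0 R1 (p \<noteq> (ipar n i \<noteq> ipar n j)) (X i j))" for p
  have Yp: "Y p \<in> mhom p" for p
    unfolding Y_def mat_hom_def using R.proj_spec(1) by blast
  have "X = Y False + Y True"
  proof (intro ext)
    fix i j
    show "X i j = (Y False + Y True) i j"
      using R.proj_sum[of "X i j"] by (cases "ipar n i = ipar n j") (auto simp: Y_def add.commute)
  qed
  then show "\<exists>x\<in>mhom False. \<exists>y\<in>mhom True. X = x + y" using Yp by blast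
qed (auto simp: mat_hom_def mmul_def fun_eq_iff algebra_simps sum.distrib)

lemma mhom_closed:
  "0 \<in> mhom p" "X \<in> mhom p \<Longrightarrow> Y \<in> mhom p \<Longrightarrow> X + Y \<in> mhom p"
  "X \<in> mhom p \<Longrightarrow> - X \<in> mhom p" "X \<in> mhom p \<Longrightarrow> Y \<in> mhom p \<Longrightarrow> X - Y \<in> mhom p"
  "X \<in> mhom p \<Longrightarrow> ssign q r X \<in> mhom p"
  "(\<And>i. i \<in> A \<Longrightarrow> Z i \<in> mhom p) \<Longrightarrow> (\<Sum>i\<in>A. Z i) \<in> mhom p"
  using M.hom_0[of p] M.hom_add[of p X Y] M.hom_uminus[of p X] M.hom_diff[of p X Y]
    M.hom_ssign[of p X q r] M.hom_sum[of A p Z] by auto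

lemma mhom_msc: "X \<in> mhom p \<Longrightarrow> msc sc r X \<in> mhom p"
  by (auto simp: mat_hom_def msc_def rhom_sc)

text \<open>The parity of the summation index enters once from each factor and cancels.\<close>

lemma mhom_mmul:
  assumes "X \<in> mhom p" "Y \<in> mhom q" shows "mmul n X Y \<in> mhom (p \<noteq> q)"
proof -
  have "rhom ((p \<noteq> q) \<noteq> (ipar n i \<noteq> ipar n j)) (X i k * Y k j)" for i j k
  proof -
    have "rhom (p \<noteq> (ipar n i \<noteq> ipar n k)) (X i k)" "rhom (q \<noteq> (ipar n k \<noteq> ipar n j)) (Y k j)"
      using assms by (auto simp: mat_hom_def)
    from rhom_mult[OF this] show ?thesis
      by (rule back_subst[of "\<lambda>b. rhom b (X i k * Y k j)"]) auto
  qed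
  then show ?thesis by (auto simp: mat_hom_def mmul_def intro!: R.hom_sum)
qed

lemma mmul_assoc: "mmul n (mmul n X Y) (Z :: 'r mat) = mmul n X (mmul n Y Z)"
proof (intro ext)
  fix i j
  have "mmul n (mmul n X Y) Z i j = (\<Sum>k<2 * n. \<Sum>l<2 * n. X i l * Y l k * Z k j)"
    by (simp add: mmul_def sum_distrib_right)
  also have "\<dots> = (\<Sum>l<2 * n. \<Sum>k<2 * n. X i l * Y l k * Z k j)" by (rule sum.swap)
  finally show "mmul n (mmul n X Y) Z i j = mmul n X (mmul n Y Z) i j"
    by (simp add: mmul_def sum_distrib_left mult.assoc)
qed

lemma mmul_msc: "mmul n (msc sc r X) Y = msc sc r (mmul n X Y)" "mmul n X (msc sc r Y) = msc sc r (mmul n X Y)"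
  by (simp_all add: mmul_def msc_def R.scale_sum_right fun_eq_iff flip: sc_mult)

lemma mmul_uminus: "mmul n (- X) (Y :: 'r mat) = - mmul n X Y" "mmul n X (- Y) = - mmul n X (Y :: 'r mat)"
  by (simp_all add: mmul_def sum_negf fun_eq_iff)

lemma mmul_diff: "mmul n (X - Y) (Z :: 'r mat) = mmul n X Z - mmul n Y Z" "mmul n Z (X - Y) = mmul n Z X - mmul n Z (Y :: 'r mat)"
  by (simp_all add: mmul_def sum_subtractf fun_eq_iff algebra_simps)

subsection \<open>Brackets\<close>

abbreviation "br \<equiv> gl_bracket R0 R1 n"

lemma br_hom: "X \<in> mhom p \<Longrightarrow> Y \<in> mhom q \<Longrightarrow> br X Y = mmul n X Y - ssign p q (mmul n Y X)"
  unfolding gl_bracket_def by (rule M.scomm_hom) auto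

lemma br_add: "br (X + Y) Z = br X Z + br Y Z" "br Z (X + Y) = br Z X + br Z Y"
  unfolding gl_bracket_def by (rule M.scomm_add_left, rule M.scomm_add_right)

lemma br_0 [simp]: "br 0 X = 0" "br X 0 = 0"
  using br_add(1)[of 0 0 X] br_add(2)[of X 0 0] by auto

lemma br_uminus: "br (- X) Y = - br X Y" "br X (- Y) = - br X Y"
  using br_add(1)[of X "- X" Y] br_add(2)[of X Y "- Y"] by (auto simp: eq_neg_iff_add_eq_0 add.commute)

lemma br_diff: "br (X - Y) Z = br X Z - br Y Z" "br Z (X - Y) = br Z X - br Z Y"
  using br_add(1)[of X "- Y" Z] br_add(2)[of Z X "- Y"] by (simp_all add: br_uminus)

lemma br_ssign: "br (ssign p q X) Y = ssign p q (br X Y)" "br X (ssign p q Y) = ssign p q (br X Y)"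
  by (simp_all add: ssign_def br_uminus)

lemma br_sum: "br (\<Sum>i\<in>A. f i) X = (\<Sum>i\<in>A. br (f i) X)" "br X (\<Sum>i\<in>A. f i) = (\<Sum>i\<in>A. br X (f i))"
  by (induction A rule: infinite_finite_induct) (auto simp: br_add)

lemma msc_ssign: "msc sc r (ssign p q X) = ssign p q (msc sc r X)"
  unfolding ssign_def using M.scale_minus_right by simp

lemma br_msc: "br (msc sc r X) Y = msc sc r (br X Y)" "br X (msc sc r Y) = msc sc r (br X Y)"
proof -
  have "br (msc sc r X) Y = msc sc r (br X Y) \<and> br X (msc sc r Y) = msc sc r (br X Y)"
  proof (induction X rule: M.hom_induct)
    case X: (hom p X)
    show ?case
    proof (induction Y rule: M.hom_induct)
      case Y: (hom q Y)
      note XY = X[unfolded hom_mhom] Y[unfolded hom_mhom]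
      show ?case
        by (simp only: br_hom[OF XY] br_hom[OF mhom_msc[OF XY(1)] XY(2)] br_hom[OF XY(1) mhom_msc[OF XY(2)]]
            mmul_msc msc_ssign M.scale_right_diff_distrib)
    next
      case (add Y Z)
      then show ?case by (simp only: br_add M.scale_right_distrib)
    qed
  next
    case (add X Z)
    then show ?case by (simp only: br_add M.scale_right_distrib)
  qed
  then show "br (msc sc r X) Y = msc sc r (br X Y)" "br X (msc sc r Y) = msc sc r (br X Y)" by auto
qed

lemma mhom_br: "X \<in> mhom p \<Longrightarrow> Y \<in> mhom q \<Longrightarrow> br X Y \<in> mhom (p \<noteq> q)"
  using mhom_mmul[of X p Y q] mhom_mmul[of Y q X p]
  by (cases p; cases q) (auto simp: br_hom intro!: mhom_closed)

lemma br_antisym: "X \<in> mhom p \<Longrightarrow> Y \<in> mhom q \<Longrightarrow> br Y X = - ssign p q (br X Y)"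
  by (cases p; cases q) (simp_all add: br_hom)

lemma br_jacobi:
  assumes "X \<in> mhom p" "Y \<in> mhom q" "Z \<in> mhom r"
  shows "br X (br Y Z) = br (br X Y) Z + ssign p q (br Y (br X Z))"
  unfolding br_hom[OF assms(1) mhom_br[OF assms(2,3)]] br_hom[OF mhom_br[OF assms(1,2)] assms(3)]
    br_hom[OF assms(2) mhom_br[OF assms(1,3)]]
  unfolding br_hom[OF assms(1,2)] br_hom[OF assms(1,3)] br_hom[OF assms(2,3)]
  by (cases p; cases q; cases r; simp add: mmul_diff M.mul_add_left M.mul_add_right mmul_uminus mmul_assoc)

subsection \<open>Entries in $S$\<close>

text \<open>The block matrix of an n by n matrix over S: the coefficients of 1 and \<omega> fill the
  upper blocks, and the lower blocks are forced by membership in \<open>Q\<close>.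
  \<open>ent\<close> reads the entries back.\<close>

definition qmat :: "(nat \<Rightarrow> nat \<Rightarrow> 'r \<times> 'r) \<Rightarrow> 'r mat" where
  "qmat f = (\<lambda>i j. if i < 2 * n \<and> j < 2 * n then
      if i < n then (if j < n then fst (f i j) else snd (f i (j - n)))
      else (if j < n then \<rho> (snd (f (i - n) j)) else \<rho> (fst (f (i - n) (j - n)))) else 0)"

definition ent :: "'r mat \<Rightarrow> nat \<Rightarrow> nat \<Rightarrow> 'r \<times> 'r" where
  "ent X i j = (X i j, X i (j + n))"

abbreviation "Q \<equiv> q_car R0 R1 n"

lemma qmat_Q [simp]: "qmat f \<in> Q"
  by (auto simp: q_car_def gl_car_def qmat_def)

lemma ent_qmat [simp]: "i < n \<Longrightarrow> j < n \<Longrightarrow> ent (qmat f) i j = f i j"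
  by (auto simp: ent_def qmat_def)

lemma QD: assumes "X \<in> Q" "i < n" "j < n"
  shows "X (i + n) (j + n) = \<rho> (X i j)" "X (i + n) j = \<rho> (X i (j + n))"
  using assms by (auto simp: q_car_def)

lemma qmat_ent: assumes "X \<in> Q" shows "qmat (ent X) = X"
proof (intro ext)
  fix i j
  have 1: "X i j = 0" if "2 * n \<le> i \<or> 2 * n \<le> j" using assms that by (auto simp: q_car_def gl_car_def)
  have 2: "X i j = \<rho> (X (i - n) (j - n))" if "n \<le> i" "i < 2 * n" "n \<le> j" "j < 2 * n"
  proof -
    have "X ((i - n) + n) ((j - n) + n) = \<rho> (X (i - n) (j - n))" by (rule QD) (use assms that in auto)
    then show ?thesis using that by simp
  qed
  have 3: "X i j = \<rho> (X (i - n) (j + n))" if "n \<le> i" "i < 2 * n" "j < n"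
  proof -
    have "X ((i - n) + n) j = \<rho> (X (i - n) (j + n))" by (rule QD) (use assms that in auto)
    then show ?thesis using that by simp
  qed
  show "qmat (ent X) i j = X i j"
    using 1 2 3 by (auto simp: qmat_def ent_def not_less not_le)
qed

lemma Q_eqI:
  assumes "X \<in> Q" "Y \<in> Q" "\<And>i j. i < n \<Longrightarrow> j < n \<Longrightarrow> ent X i j = ent Y i j"
  shows "X = Y"
proof -
  have "qmat (ent X) = qmat (ent Y)"
    using assms(3) by (auto simp: qmat_def fun_eq_iff prod_eq_iff)
  then show ?thesis using assms(1,2) by (simp add: qmat_ent)
qed

lemma ent_simps [simp]: "ent 0 i j = 0" "ent (X + Y) i j = ent X i j + ent Y i j"
  "ent (- X) i j = - ent X i j" "ent (X - Y) i j = ent X i j - ent Y i j"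
  "ent (msc sc r X) i j = ssc r (ent X i j)" "ent (ssign p q X) i j = ssign p q (ent X i j)"
  by (auto simp: ent_def msc_def ssc_def ssign_def prod_eq_iff)

lemma ent_sum: "ent (\<Sum>k\<in>A. f k) i j = (\<Sum>k\<in>A. ent (f k) i j)"
  by (rule sum_comp_morphism[of "\<lambda>X. ent X i j", unfolded o_def, symmetric]) simp_all

lemma Q_closed [simp]: "0 \<in> Q" "X \<in> Q \<Longrightarrow> Y \<in> Q \<Longrightarrow> X + Y \<in> Q"
  "X \<in> Q \<Longrightarrow> - X \<in> Q" "X \<in> Q \<Longrightarrow> Y \<in> Q \<Longrightarrow> X - Y \<in> Q" "X \<in> Q \<Longrightarrow> msc sc r X \<in> Q"
  "X \<in> Q \<Longrightarrow> ssign p q X \<in> Q"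
  by (auto simp: q_car_def gl_car_def msc_def ssign_def)

lemma Q_sum: "(\<And>k. k \<in> A \<Longrightarrow> f k \<in> Q) \<Longrightarrow> (\<Sum>k\<in>A. f k) \<in> Q"
  by (induction A rule: infinite_finite_induct) auto

lemma Q_mmul [simp]:
  assumes "X \<in> Q" "Y \<in> Q" shows "mmul n X Y \<in> Q"
proof -
  have "mmul n X Y \<in> gl_car n"
    using assms by (auto simp: q_car_def gl_car_def mmul_def)
  then show ?thesis
    by (auto simp: q_car_def mmul_def sum_lessThan_double rho_sum QD[OF assms(1)] QD[OF assms(2)] add.commute
        intro!: sum.cong)
qed

text \<open>The sum over 2n indices splits into two halves. In the second half the lower blocks of
  \<open>Y\<close> contribute \<rho> of its upper blocks, and this is exactly the twist in
  \<open>smul\<close> caused by moving \<omega> past an element of the ring.\<close>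

lemma ent_mmul:
  assumes "Y \<in> Q" "j < n"
  shows "ent (mmul n X Y) i j = (\<Sum>k<n. ent X i k \<bullet> ent Y k j)"
proof -
  have "fst (\<Sum>k\<in>A. f k) = (\<Sum>k\<in>A. fst (f k))" "snd (\<Sum>k\<in>A. f k) = (\<Sum>k\<in>A. snd (f k))"
    for f :: "nat \<Rightarrow> 'r \<times> 'r" and A
    by (induction A rule: infinite_finite_induct) auto
  then show ?thesis
    by (simp add: ent_def mmul_def sum_lessThan_double smul_def prod_eq_iff QD[OF assms(1) _ assms(2)])
qed

lemma shom_ent: "X \<in> mhom p \<Longrightarrow> i < n \<Longrightarrow> j < n \<Longrightarrow> shom p (ent X i j)"
  unfolding mat_hom_def shom_def ent_def
  by (elim CollectE, frule spec2[of _ i j], drule spec2[of _ i "j + n"]) (simp add: ipar_def)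

lemma qmat_mhom: "(\<And>i j. i < n \<Longrightarrow> j < n \<Longrightarrow> shom p (f i j)) \<Longrightarrow> qmat f \<in> mhom p"
  by (cases p) (auto simp: mat_hom_def shom_def qmat_def ipar_def not_le rhom_rho)

section \<open>Elementary matrices over S\<close>

definition elem :: "nat \<Rightarrow> nat \<Rightarrow> 'r \<times> 'r \<Rightarrow> 'r mat" where
  "elem i j s = qmat (\<lambda>k l. if k = i \<and> l = j then s else 0)"

lemma elem_Q [simp]: "elem i j s \<in> Q"
  by (simp add: elem_def)

lemma ent_elem: "k < n \<Longrightarrow> l < n \<Longrightarrow> ent (elem i j s) k l = (if k = i \<and> l = j then s else 0)"
  by (simp add: elem_def)

lemma elem_mhom: "shom p s \<Longrightarrow> elem i j s \<in> mhom p"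
  unfolding elem_def by (rule qmat_mhom) simp

lemma elem_simps: "elem i j 0 = 0" "elem i j (s + t) = elem i j s + elem i j t"
  "elem i j (- s) = - elem i j s" "elem i j (s - t) = elem i j s - elem i j t"
  "elem i j (ssc r s) = msc sc r (elem i j s)" "elem i j (ssign p q s) = ssign p q (elem i j s)"
  by (rule Q_eqI; simp add: ent_elem; simp add: ssc_def zero_prod_def)+

lemma mmul_elem:
  assumes "i < n" "j < n" "k < n" "l < n"
  shows "mmul n (elem i j s) (elem k l t) = (if j = k then elem i l (s \<bullet> t) else 0)"
proof (rule Q_eqI)
  fix a b assume "a < n" "b < n"
  have "ent (mmul n (elem i j s) (elem k l t)) a b
      = (\<Sum>m<n. if m = j then (if a = i then s else 0) \<bullet> (if j = k \<and> b = l then t else 0) else 0)"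
    unfolding ent_mmul[OF elem_Q \<open>b < n\<close>] using \<open>a < n\<close> \<open>b < n\<close>
    by (intro sum.cong) (auto simp: ent_elem)
  then show "ent (mmul n (elem i j s) (elem k l t)) a b = ent (if j = k then elem i l (s \<bullet> t) else 0) a b"
    using assms \<open>a < n\<close> \<open>b < n\<close> by (auto simp: ent_elem sum.delta)
qed auto

lemma br_elem:
  assumes "shom p s" "shom q t" "i < n" "j < n" "k < n" "l < n"
  shows "br (elem i j s) (elem k l t) = (if j = k then elem i l (s \<bullet> t) else 0)
     - ssign p q (if l = i then elem k j (t \<bullet> s) else 0)"
  using assms by (simp add: br_hom[OF elem_mhom elem_mhom] mmul_elem)

lemma Q_decompose: assumes "X \<in> Q" shows "X = (\<Sum>i<n. \<Sum>j<n. elem i j (ent X i j))"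
proof (rule Q_eqI)
  fix a b assume ab: "a < n" "b < n"
  have "ent (\<Sum>i<n. \<Sum>j<n. elem i j (ent X i j)) a b
      = (\<Sum>i<n. \<Sum>j<n. if i = a then (if j = b then ent X a b else 0) else 0)"
    unfolding ent_sum by (intro sum.cong) (auto simp: ent_elem ab)
  also have "\<dots> = (\<Sum>i<n. if i = a then (\<Sum>j<n. if j = b then ent X a b else 0) else 0)"
    by (intro sum.cong) auto
  finally show "ent X a b = ent (\<Sum>i<n. \<Sum>j<n. elem i j (ent X i j)) a b"
    using ab by (simp add: sum.delta)
qed (auto intro!: Q_sum assms)

lemma br_Q: "X \<in> Q \<Longrightarrow> Y \<in> Q \<Longrightarrow> X \<in> mhom p \<Longrightarrow> Y \<in> mhom q \<Longrightarrow> br X Y \<in> Q"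
  by (simp add: br_hom)

subsection \<open>The derived algebra\<close>

abbreviation "L \<equiv> sq_car sc R0 R1 n"

lemma L_subspace: "M.subspace L"
  unfolding sq_car_def by (rule M.subspace_kspan)

lemmas L_closed [simp] = M.subspace_0[OF L_subspace] M.subspace_add[OF L_subspace]
  M.subspace_diff[OF L_subspace] M.subspace_neg[OF L_subspace] M.subspace_scale[OF L_subspace]
  M.subspace_sum[OF L_subspace]

lemma L_ssign [simp]: "X \<in> L \<Longrightarrow> ssign p q X \<in> L"
  by (simp add: ssign_def)

lemma br_L: "X \<in> Q \<Longrightarrow> Y \<in> Q \<Longrightarrow> X \<in> mhom p \<Longrightarrow> Y \<in> mhom q \<Longrightarrow> br X Y \<in> L"
  unfolding sq_car_def by (rule kspan.gen) blast

lemma L_sub_Q: "L \<subseteq> Q"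
  unfolding sq_car_def by (rule M.kspan_minimal) (auto simp: M.subspace_def br_Q)

lemma idx [simp]: "0 < n" "Suc 0 < n" "2 < n"
  using n3 by auto

text \<open>A third index exhibits each off-diagonal e_ij(s) as the bracket of e_ik(s) and e_kj(1),
  so all root vectors lie in the derived algebra.\<close>

lemma other_index: "\<exists>k<n. k \<noteq> i \<and> k \<noteq> j"
proof -
  have "\<not> {0, 1, 2} \<subseteq> {i, j}" using card_mono[of "{i, j}" "{0, 1, 2}"] by (auto simp: card_insert_if)
  then show ?thesis using n3 by (auto intro: exI[of _ 0] exI[of _ 1] exI[of _ 2])
qed

lemma elem_L_hom:
  assumes "shom p s" "i < n" "j < n" "i \<noteq> j" shows "elem i j s \<in> L"
proof -
  obtain k where k: "k < n" "k \<noteq> i" "k \<noteq> j" using other_index by blast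
  have "br (elem i k s) (elem k j \<one>) = elem i j s" using assms k by (simp add: br_elem[of p _ False])
  then show ?thesis
    using br_L[of "elem i k s" "elem k j \<one>" p False] assms by (simp add: elem_mhom)
qed

lemma shom_decompose: "\<exists>s0 s1. shom False s0 \<and> shom True s1 \<and> s = s0 + s1"
proof -
  obtain a b c d where "rhom False a" "rhom True b" "fst s = a + b" "rhom True c" "rhom False d" "snd s = c + d"
    using R.hom_decomp[of False "fst s"] R.hom_decomp[of True "snd s"] by auto
  then show ?thesis
    by (intro exI[of _ "(a, c)"] exI[of _ "(b, d)"]) (auto simp: shom_def prod_eq_iff)
qed

lemma shom_induct [case_names hom add]:
  assumes "\<And>p s. shom p s \<Longrightarrow> P s" "\<And>s t. P s \<Longrightarrow> P t \<Longrightarrow> P (s + t)" shows "P s"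
  using shom_decompose[of s] assms by metis

lemma elem_L [simp]: "i < n \<Longrightarrow> j < n \<Longrightarrow> i \<noteq> j \<Longrightarrow> elem i j s \<in> L"
proof (induction s rule: shom_induct)
  case (hom p s)
  then show ?case using elem_L_hom by blast
next
  case (add s t)
  then show ?case unfolding elem_simps(2) using L_closed(2) by blast
qed

lemma halves: "sc u a + sc u a = a"
proof -
  have "u + u = 1" using half by (simp only: mult_2)
  then show ?thesis by (simp only: R.scale_left_distrib[symmetric] R.scale_one)
qed

text \<open>The torus lies in the derived algebra because $[\omega, \omega] = 2$.\<close>

lemma elem_diag_L [simp]:
  assumes "i < n" shows "elem i i \<one> \<in> L"
proof -
  have hom: "shom True (0, e)" "shom True (0, sc u e)" by (auto simp: shom_def rhom_sc)
  have "br (elem i i (0, sc u e)) (elem i i (0, e)) = elem i i ((0, sc u e) \<bullet> (0, e) + (0, e) \<bullet> (0, sc u e))"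
    using assms by (simp add: br_elem[OF hom(2,1)] elem_simps)
  also have "(0, sc u e) \<bullet> (0, e) + (0, e) \<bullet> (0, sc u e) = \<one>"
    by (simp add: smul_def halves)
  finally show ?thesis
    using br_L[OF elem_Q elem_Q elem_mhom[OF hom(2)] elem_mhom[OF hom(1)]] by metis
qed

definition root_gens :: "'r mat set" where
  "root_gens = {elem i j s | i j s p. i < n \<and> j < n \<and> i \<noteq> j \<and> shom p s}"

definition diag_gens :: "'r mat set" where
  "diag_gens = {br (elem i j s) (elem j i t) | i j s t p q. i < n \<and> j < n \<and> i \<noteq> j \<and> shom p s \<and> shom q t}"

text \<open>Brackets of elementary matrices are root vectors, brackets of opposite root vectors, or
  zero, up to sign, with one exception: two matrices at the same diagonal position.\<close>

lemma L_generated: "L \<subseteq> kspan (msc sc) (root_gens \<union> diag_gens)"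
proof -
  let ?K = "kspan (msc sc) (root_gens \<union> diag_gens)"
  have sub: "M.subspace ?K" by (rule M.subspace_kspan)
  note K = M.subspace_0[OF sub] M.subspace_add[OF sub] M.subspace_diff[OF sub] M.subspace_neg[OF sub]
    M.subspace_sum[OF sub]
  have Ks: "ssign p q X \<in> ?K" if "X \<in> ?K" for p q X using that K by (simp add: ssign_def)
  have root: "elem i j s \<in> ?K" if "i < n" "j < n" "i \<noteq> j" "shom p s" for i j p s
    using that unfolding root_gens_def by (intro kspan.gen) blast
  have diag: "br (elem i j s) (elem j i t) \<in> ?K"
    if "i < n" "j < n" "i \<noteq> j" "shom p s" "shom q t" for i j p q s t
    using that unfolding diag_gens_def by (intro kspan.gen) blast
  have el: "br (elem i j s) (elem k l t) \<in> ?K"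
    if ij: "i < n" "j < n" "k < n" "l < n" and st: "shom p s" "shom q t" for i j k l p q s t
  proof (cases "j = k \<and> l = i")
    case jk: True
    show ?thesis
    proof (cases "i = j")
      case True
      obtain m where m: "m < n" "m \<noteq> i" using other_index by blast
      \<comment> \<open>The bracket of e_ii(s) and e_ii(t) is rerouted through an auxiliary index m.
        Both brackets on the left have an entry at (m, m) built from t s, and the signed difference
        cancels it.\<close>
      have "br (elem i m s) (elem m i t) - ssign p q (br (elem i m \<one>) (elem m i (t \<bullet> s)))
          = br (elem i j s) (elem k l t)"
        using True jk m ij st shom_smul[OF st(2,1)] by (simp add: br_elem[of _ _ _] br_elem[of False _ "q \<noteq> p"] br_elem[OF st] ssign_diff)
      moreover have "br (elem i m s) (elem m i t) - ssign p q (br (elem i m \<one>) (elem m i (t \<bullet> s))) \<in> ?K"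
        using m ij shom_smul[OF st(2,1)] st by (intro K Ks diag[of i m p s q t] diag[of i m False "\<one>" "q \<noteq> p"]) auto
      ultimately show ?thesis by simp
    next
      case False
      then show ?thesis using diag jk that by blast
    qed
  next
    case False
    then show ?thesis
      using root[OF ij(1,4) _ shom_smul[OF st]] root[OF ij(3,2) _ shom_smul[OF st(2,1)]]
      unfolding br_elem[OF st ij] by (auto intro!: K Ks)
  qed
  have "br X Y \<in> ?K" if X: "X \<in> Q" "X \<in> mhom p" and Y: "Y \<in> Q" "Y \<in> mhom q" for X Y p q
  proof -
    have "br X Y = (\<Sum>k<n. \<Sum>l<n. \<Sum>i<n. \<Sum>j<n. br (elem i j (ent X i j)) (elem k l (ent Y k l)))"
      by (subst Q_decompose[OF X(1)], subst Q_decompose[OF Y(1)]) (simp add: br_sum)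
    also have "\<dots> \<in> ?K"
      by (intro K(5) el[of _ _ _ _ p _ q]) (use X Y in \<open>auto simp: shom_ent\<close>)
    finally show ?thesis .
  qed
  then show ?thesis unfolding sq_car_def by (intro M.kspan_minimal sub) auto
qed

end

section \<open>The odd trace form\<close>

context superalg
begin

text \<open>Up to the choice of \<open>lam\<close>, this is the \<open>\<omega>\<close>-component of the product of \<open>s\<close> and \<open>t\<close>.\<close>

definition odd_form :: "('r \<Rightarrow> 'r \<Rightarrow> 'v::ab_group_add) \<Rightarrow> 'r \<times> 'r \<Rightarrow> 'r \<times> 'r \<Rightarrow> 'v" where
  "odd_form lam s t = lam (fst s) (snd t) + lam (snd s) (\<rho> (fst t))"

end

definition (in queer) trace_form :: "('r \<Rightarrow> 'r \<Rightarrow> 'v::ab_group_add) \<Rightarrow> 'r mat \<Rightarrow> 'r mat \<Rightarrow> 'v" where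
  "trace_form lam X Y = (\<Sum>i<n. \<Sum>j<n. odd_form lam (ent X i j) (ent Y j i))"

text \<open>These are the identities satisfied by the values of a character on the generators of
  \<langle>R, R\<rangle>. The target has no scalars, so \<open>lam_sc\<close> only moves a scalar
  across.\<close>

locale cyclic_form = queer sc e R0 R1 n u
  for sc :: "'k::comm_ring_1 \<Rightarrow> 'r::ring \<Rightarrow> 'r" and e :: 'r and R0 R1 :: "'r set" and n :: nat and u :: 'k +
  fixes lam :: "'r \<Rightarrow> 'r \<Rightarrow> 'v::ab_group_add"
  assumes lam_add: "lam (a + b) c = lam a c + lam b c" "lam a (b + c) = lam a b + lam a c"
    and lam_sc: "lam (sc x a) b = lam a (sc x b)"
    and lam_antisym: "rhom p a \<Longrightarrow> rhom q b \<Longrightarrow> lam a b + ssign p q (lam b a) = 0"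
    and lam_cyclic: "rhom p a \<Longrightarrow> rhom q b \<Longrightarrow> rhom r c \<Longrightarrow>
      ssign p r (lam (a * b) c) + ssign q p (lam (b * c) a) + ssign r q (lam (c * a) b) = 0"
begin

lemma lam_0 [simp]: "lam 0 a = 0" "lam a 0 = 0"
  using lam_add(1)[of 0 0 a] lam_add(2)[of a 0 0] by auto

lemma lam_uminus [simp]: "lam (- a) b = - lam a b" "lam a (- b) = - lam a b"
  using lam_add(1)[of a "- a" b] lam_add(2)[of a b "- b"] by (auto simp: eq_neg_iff_add_eq_0 add.commute)

lemma lam_diff: "lam (a - b) c = lam a c - lam b c" "lam c (a - b) = lam c a - lam c b"
  using lam_add(1)[of a "- b" c] lam_add(2)[of c a "- b"] by simp_all

lemma lam_swap: "rhom p a \<Longrightarrow> rhom q b \<Longrightarrow> lam b a = - ssign p q (lam a b)"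
  using lam_antisym[of q b p a] by (cases p; cases q) (simp_all add: eq_neg_iff_add_eq_0)

text \<open>The cyclic relation solved for its first term. In this shape it describes how a product
  is taken apart inside a trace.\<close>

lemma lam_mult:
  assumes "rhom p a" "rhom q b" "rhom r c"
  shows "lam (a * b) c = lam a (b * c) + ssign p (q \<noteq> r) (lam b (c * a))"
  using lam_cyclic[OF assms] lam_swap[OF assms(1) rhom_mult[OF assms(2,3)]]
    lam_swap[OF assms(2) rhom_mult[OF assms(3,1)]]
  by (cases p; cases q; cases r; simp add: add_eq_0_iff algebra_simps)

text \<open>Taking both other factors equal to \<open>e\<close> gives
  \<open>lam a e = lam a e + lam e a\<close>, so \<open>lam e a\<close> vanishes, and antisymmetry
  transfers this to the other side.\<close>

lemma lam_e: "lam a e = 0"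
proof (induction a rule: R.hom_induct)
  case (hom p a)
  show ?case using lam_mult[OF hom rhom_e rhom_e] lam_swap[OF hom rhom_e] by simp
qed (simp add: lam_add)

lemma odd_form_add: "odd_form lam (s + t) v = odd_form lam s v + odd_form lam t v"
  "odd_form lam v (s + t) = odd_form lam v s + odd_form lam v t"
  by (simp_all add: odd_form_def lam_add algebra_simps)

lemma odd_form_0 [simp]: "odd_form lam 0 s = 0" "odd_form lam s 0 = 0"
  by (simp_all add: odd_form_def)

lemma odd_form_uminus [simp]: "odd_form lam (- s) t = - odd_form lam s t" "odd_form lam s (- t) = - odd_form lam s t"
  by (simp_all add: odd_form_def)

lemma odd_form_ssc: "odd_form lam (ssc r s) t = odd_form lam s (ssc r t)"
  by (simp add: odd_form_def ssc_def lam_sc)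

lemma odd_form_sum: "odd_form lam (\<Sum>i\<in>A. f i) s = (\<Sum>i\<in>A. odd_form lam (f i) s)"
  "odd_form lam s (\<Sum>i\<in>A. f i) = (\<Sum>i\<in>A. odd_form lam s (f i))"
  by (induction A rule: infinite_finite_induct) (simp_all add: odd_form_add)

text \<open>The \<rho> inside \<open>odd_form\<close> supplies exactly the sign by which the parity
  of b \<omega> in S differs from that of b in the ring.\<close>

lemma odd_form_swap:
  assumes "shom p s" "shom q t"
  shows "odd_form lam t s = - ssign p q (odd_form lam s t)"
proof -
  have h: "rhom p (fst s)" "rhom (\<not> p) (snd s)" "rhom q (fst t)" "rhom (\<not> q) (snd t)"
    using assms by (auto simp: shom_def)
  show ?thesis
    unfolding odd_form_def rho_hom[OF h(1)] rho_hom[OF h(3)]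
    using lam_swap[OF h(1,4)] lam_swap[OF h(2,3)]
    by (cases p; cases q; simp)
qed

text \<open>Expanded into components, the left side has four terms, and \<open>lam_mult\<close>
  applies to each of them. The twists by \<rho> account for the remaining signs.\<close>

lemma odd_form_mult:
  assumes "shom p s" "shom q t" "shom r v"
  shows "odd_form lam (s \<bullet> t) v = odd_form lam s (t \<bullet> v) + ssign p (q \<noteq> r) (odd_form lam t (v \<bullet> s))"
proof -
  have h: "rhom p (fst s)" "rhom (\<not> p) (snd s)" "rhom q (fst t)" "rhom (\<not> q) (snd t)"
    "rhom r (fst v)" "rhom (\<not> r) (snd v)"
    using assms by (auto simp: shom_def)
  note rh = rho_hom[OF h(1)] rho_hom[OF h(2)] rho_hom[OF h(3)] rho_hom[OF h(4)] rho_hom[OF h(5)] rho_hom[OF h(6)]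
  note m = lam_mult[OF h(1,3,6)] lam_mult[OF h(2,4,6)] lam_mult[OF h(1,4,5)] lam_mult[OF h(2,3,5)]
  show ?thesis
    unfolding odd_form_def smul_def fst_conv snd_conv rho_add rho_mult rho_rho rh
    by (cases p; cases q; cases r; simp add: lam_add lam_diff m rh)
qed

section \<open>The cocycle identity for the trace form\<close>

abbreviation "tf \<equiv> trace_form lam"

lemma tf_add: "tf (X + Y) Z = tf X Z + tf Y Z" "tf Z (X + Y) = tf Z X + tf Z Y"
  by (simp_all add: trace_form_def odd_form_add sum.distrib)

lemma tf_uminus: "tf (- X) Y = - tf X Y" "tf X (- Y) = - tf X Y"
  by (simp_all add: trace_form_def sum_negf)

lemma tf_diff: "tf (X - Y) Z = tf X Z - tf Y Z" "tf Z (X - Y) = tf Z X - tf Z Y"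
  using tf_add(1)[of X "- Y" Z] tf_add(2)[of Z X "- Y"] by (simp_all add: tf_uminus)

lemma tf_msc: "tf (msc sc r X) Y = tf X (msc sc r Y)"
  by (simp add: trace_form_def odd_form_ssc)

lemma tf_swap:
  assumes "X \<in> mhom p" "Y \<in> mhom q"
  shows "tf Y X = - ssign p q (tf X Y)"
proof -
  have "tf Y X = (\<Sum>i<n. \<Sum>j<n. - ssign p q (odd_form lam (ent X j i) (ent Y i j)))"
    unfolding trace_form_def
    by (intro sum.cong refl odd_form_swap shom_ent assms) auto
  also have "\<dots> = - ssign p q (\<Sum>i<n. \<Sum>j<n. odd_form lam (ent X j i) (ent Y i j))"
    by (simp add: sum_negf ssign_sum)
  finally show ?thesis unfolding trace_form_def by (subst (asm) sum.swap)
qed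

text \<open>Holds entry by entry through \<open>odd_form_mult\<close>. The work lies in bringing the
  three triple sums to the same order of summation.\<close>

lemma tf_mmul:
  assumes "X \<in> mhom p" "Y \<in> mhom q" "Z \<in> mhom r" and Q: "X \<in> Q" "Y \<in> Q" "Z \<in> Q"
  shows "tf (mmul n X Y) Z = tf X (mmul n Y Z) + ssign p (q \<noteq> r) (tf Y (mmul n Z X))"
proof -
  let ?T = "\<lambda>i j k. odd_form lam (ent X i k \<bullet> ent Y k j) (ent Z j i)"
  let ?A = "\<lambda>i j k. odd_form lam (ent X i k) (ent Y k j \<bullet> ent Z j i)"
  let ?B = "\<lambda>i j k. odd_form lam (ent Y k j) (ent Z j i \<bullet> ent X i k)"
  have 1: "tf (mmul n X Y) Z = (\<Sum>i<n. \<Sum>j<n. \<Sum>k<n. ?T i j k)"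
    unfolding trace_form_def by (intro sum.cong) (auto simp: ent_mmul Q odd_form_sum)
  have 2: "tf X (mmul n Y Z) = (\<Sum>i<n. \<Sum>j<n. \<Sum>k<n. ?A i j k)"
    unfolding trace_form_def
    by (subst (2) sum.swap) (auto simp: ent_mmul Q odd_form_sum intro!: sum.cong)
  have "tf Y (mmul n Z X) = (\<Sum>k<n. \<Sum>j<n. \<Sum>i<n. ?B i j k)"
    unfolding trace_form_def by (intro sum.cong) (auto simp: ent_mmul Q odd_form_sum)
  also have "\<dots> = (\<Sum>k<n. \<Sum>i<n. \<Sum>j<n. ?B i j k)" by (intro sum.cong refl sum.swap)
  also have "\<dots> = (\<Sum>i<n. \<Sum>k<n. \<Sum>j<n. ?B i j k)" by (rule sum.swap)
  also have "\<dots> = (\<Sum>i<n. \<Sum>j<n. \<Sum>k<n. ?B i j k)" by (intro sum.cong refl sum.swap)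
  finally have 3: "tf Y (mmul n Z X) = \<dots>" .
  have "?T i j k = ?A i j k + ssign p (q \<noteq> r) (?B i j k)" if "i < n" "j < n" "k < n" for i j k
    by (intro odd_form_mult shom_ent assms that)
  then have "(\<Sum>i<n. \<Sum>j<n. \<Sum>k<n. ?T i j k)
      = (\<Sum>i<n. \<Sum>j<n. \<Sum>k<n. ?A i j k + ssign p (q \<noteq> r) (?B i j k))"
    by (intro sum.cong) auto
  then show ?thesis unfolding 1 2 3 by (simp add: sum.distrib ssign_sum)
qed

text \<open>This is the identity that makes the trace map kill the image of d_3, so that it descends
  to second homology.\<close>

lemma tf_br_cyclic:
  assumes "X \<in> mhom p" "Y \<in> mhom q" "Z \<in> mhom r" "X \<in> Q" "Y \<in> Q" "Z \<in> Q"
  shows "ssign p r (tf (br X Y) Z) + ssign q p (tf (br Y Z) X) + ssign r q (tf (br Z X) Y) = 0"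
proof -
  note X = assms(1,4) and Y = assms(2,5) and Z = assms(3,6)
  have 1: "tf (mmul n X Y) Z = tf X (mmul n Y Z) + ssign p (q \<noteq> r) (tf Y (mmul n Z X))"
    and 2: "tf (mmul n Y X) Z = tf Y (mmul n X Z) + ssign q (p \<noteq> r) (tf X (mmul n Z Y))"
    using assms by (blast intro: tf_mmul)+
  note sw = tf_swap[OF X(1) mhom_mmul[OF Y(1) Z(1)]] tf_swap[OF X(1) mhom_mmul[OF Z(1) Y(1)]]
    tf_swap[OF Y(1) mhom_mmul[OF Z(1) X(1)]] tf_swap[OF Y(1) mhom_mmul[OF X(1) Z(1)]]
  show ?thesis
    unfolding br_hom[OF X(1) Y(1)] br_hom[OF Y(1) Z(1)] br_hom[OF Z(1) X(1)]
    by (cases p; cases q; cases r; simp add: tf_diff tf_add tf_uminus 1 2 sw)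
qed

lemma tf_br:
  assumes "X \<in> mhom p" "Y \<in> mhom q" "Z \<in> mhom r" "X \<in> Q" "Y \<in> Q" "Z \<in> Q"
  shows "tf (br X Y) Z = tf X (br Y Z) - ssign p q (tf Y (br X Z))"
  using tf_br_cyclic[OF assms] tf_swap[OF assms(1) mhom_br[OF assms(2,3)]]
    tf_swap[OF assms(2) mhom_br[OF assms(1,3)]] br_antisym[OF assms(1,3)]
  by (cases p; cases q; cases r; simp add: tf_uminus algebra_simps add_eq_0_iff)

lemma tf_elem:
  assumes "i < n" "j < n" "k < n" "l < n"
  shows "tf (elem i j s) (elem k l t) = (if j = k \<and> l = i then odd_form lam s t else 0)"
proof -
  have "tf (elem i j s) (elem k l t)
      = (\<Sum>a<n. \<Sum>b<n. if a = i then (if b = j then (if j = k \<and> l = i then odd_form lam s t else 0) else 0) else 0)"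
    unfolding trace_form_def by (intro sum.cong refl) (auto simp: ent_elem)
  also have "\<dots> = (\<Sum>a<n. if a = i then (\<Sum>b<n. if b = j then (if j = k \<and> l = i then odd_form lam s t else 0) else 0) else 0)"
    by (intro sum.cong) auto
  finally show ?thesis using assms by simp
qed

end

section \<open>Cocycles on the special queer Lie superalgebra\<close>

text \<open>The counterpart of \<open>cyclic_form\<close> for second homology: the values of a
  character on pairs from \<open>L\<close>. Everything up to \<open>bet_splits\<close> determines
  what such a form looks like.\<close>

locale lie_form = queer sc e R0 R1 n u
  for sc :: "'k::comm_ring_1 \<Rightarrow> 'r::ring \<Rightarrow> 'r" and e :: 'r and R0 R1 :: "'r set" and n :: nat and u :: 'k +
  fixes bet :: "'r mat \<Rightarrow> 'r mat \<Rightarrow> 'v::ab_group_add"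
  assumes bet_add: "X \<in> L \<Longrightarrow> Y \<in> L \<Longrightarrow> Z \<in> L \<Longrightarrow> bet (X + Y) Z = bet X Z + bet Y Z"
      "X \<in> L \<Longrightarrow> Y \<in> L \<Longrightarrow> Z \<in> L \<Longrightarrow> bet Z (X + Y) = bet Z X + bet Z Y"
    and bet_msc: "X \<in> L \<Longrightarrow> Y \<in> L \<Longrightarrow> bet (msc sc x X) Y = bet X (msc sc x Y)"
    and bet_antisym: "X \<in> L \<Longrightarrow> Y \<in> L \<Longrightarrow> X \<in> mhom p \<Longrightarrow> Y \<in> mhom q \<Longrightarrow>
      bet X Y + ssign p q (bet Y X) = 0"
    and bet_cyclic: "X \<in> L \<Longrightarrow> Y \<in> L \<Longrightarrow> Z \<in> L \<Longrightarrow> X \<in> mhom p \<Longrightarrow> Y \<in> mhom q \<Longrightarrow> Z \<in> mhom r \<Longrightarrow>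
      ssign p r (bet (br X Y) Z) + ssign q p (bet (br Y Z) X) + ssign r q (bet (br Z X) Y) = 0"
begin

lemma bet_0: assumes "X \<in> L" shows "bet 0 X = 0" "bet X 0 = 0"
  using bet_add(1)[of 0 0 X] bet_add(2)[of 0 0 X] assms by auto

lemma bet_uminus: assumes "X \<in> L" "Y \<in> L" shows "bet (- X) Y = - bet X Y" "bet X (- Y) = - bet X Y"
  using bet_add(1)[of X "- X" Y] bet_add(2)[of Y "- Y" X] assms
  by (auto simp: bet_0 eq_neg_iff_add_eq_0 add.commute)

lemma bet_swap: "X \<in> L \<Longrightarrow> Y \<in> L \<Longrightarrow> X \<in> mhom p \<Longrightarrow> Y \<in> mhom q \<Longrightarrow> bet Y X = - ssign p q (bet X Y)"
  using bet_antisym[of X Y p q] by (cases p; cases q) (simp_all add: eq_neg_iff_add_eq_0 add.commute)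

lemma br_in_L: "X \<in> L \<Longrightarrow> Y \<in> L \<Longrightarrow> X \<in> mhom p \<Longrightarrow> Y \<in> mhom q \<Longrightarrow> br X Y \<in> L"
  using br_L[of X Y p q] L_sub_Q by blast

lemma bet_br:
  assumes "X \<in> L" "Y \<in> L" "Z \<in> L" "X \<in> mhom p" "Y \<in> mhom q" "Z \<in> mhom r"
  shows "bet (br X Y) Z = bet X (br Y Z) - ssign p q (bet Y (br X Z))"
  using bet_cyclic[OF assms]
    bet_swap[OF assms(1) br_in_L[OF assms(2,3,5,6)] assms(4) mhom_br[OF assms(5,6)]]
    bet_swap[OF assms(2) br_in_L[OF assms(1,3,4,6)] assms(5) mhom_br[OF assms(4,6)]]
    br_antisym[OF assms(4,6)]
  by (cases p; cases q; cases r;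
      simp add: bet_uminus assms br_in_L[OF assms(1,3,4,6)] algebra_simps add_eq_0_iff)

lemma bet_jacobi:
  assumes "X \<in> L" "Y \<in> L" "Z \<in> L" "X \<in> mhom p" "Y \<in> mhom q" "Z \<in> mhom r"
  shows "bet X (br Y Z) = bet (br X Y) Z + ssign p q (bet Y (br X Z))"
  using bet_br[OF assms] by simp

subsection \<open>Opposite root vectors\<close>

definition H :: "nat \<Rightarrow> nat \<Rightarrow> 'r \<times> 'r \<Rightarrow> 'r \<times> 'r \<Rightarrow> 'v" where
  "H i j s t = bet (elem i j s) (elem j i t)"

context
  fixes i j assumes ij: "i < n" "j < n" "i \<noteq> j"
begin

lemma H_add: "H i j (s + t) v = H i j s v + H i j t v" "H i j v (s + t) = H i j v s + H i j v t"
  using ij by (simp_all add: H_def elem_simps bet_add)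

lemma H_0: "H i j 0 v = 0" "H i j v 0 = 0"
  using ij by (simp_all add: H_def elem_simps bet_0)

lemma H_uminus: "H i j (- s) v = - H i j s v" "H i j s (- v) = - H i j s v"
  using ij by (simp_all add: H_def elem_simps bet_uminus)

lemma H_ssc: "H i j (ssc r s) v = H i j s (ssc r v)"
  using ij by (simp add: H_def elem_simps bet_msc)

lemma H_swap: "shom p s \<Longrightarrow> shom q t \<Longrightarrow> H j i t s = - ssign p q (H i j s t)"
  using ij unfolding H_def by (intro bet_swap) (auto simp: elem_mhom)

text \<open>Trades the pair (i, j) for the pairs (i, k) and (j, k). With one argument equal to
  \<one> it compares values at different indices.\<close>

lemma H_jacobi:
  assumes "k < n" "k \<noteq> i" "k \<noteq> j" and hom: "shom p s" "shom q t" "shom r v"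
  shows "H i j s (t \<bullet> v) = H i k (s \<bullet> t) v - ssign p (q \<noteq> r) (H j k t (v \<bullet> s))"
proof -
  have "bet (elem i j s) (br (elem j k t) (elem k i v))
      = bet (br (elem i j s) (elem j k t)) (elem k i v)
        + ssign p q (bet (elem j k t) (br (elem i j s) (elem k i v)))"
    using ij assms by (intro bet_jacobi[where r = r]) (auto simp: elem_mhom)
  moreover have "br (elem j k t) (elem k i v) = elem j i (t \<bullet> v)"
    "br (elem i j s) (elem j k t) = elem i k (s \<bullet> t)"
    "br (elem i j s) (elem k i v) = - ssign p r (elem k j (v \<bullet> s))"
    using ij assms by (simp_all add: br_elem[OF hom(1) hom(2)] br_elem[OF hom(1) hom(3)] br_elem[OF hom(2) hom(3)])
  ultimately show ?thesis
    using ij assms(1-3) by (cases p; cases q; cases r; simp add: H_def bet_uminus)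
qed

end

text \<open>The subtracted term depends on \<open>s\<close> and \<open>t\<close> only through their
  product, hence can be absorbed into a function of the bracket. What is left carries the cyclic
  part.\<close>

definition ell :: "'r \<times> 'r \<Rightarrow> 'r \<times> 'r \<Rightarrow> 'v" where
  "ell s t = H 1 0 s t - H 1 0 (s \<bullet> t) \<one>"

lemma ell_add: "ell (s + t) v = ell s v + ell t v" "ell v (s + t) = ell v s + ell v t"
  by (simp_all add: ell_def H_add smul_add)

lemma ell_0 [simp]: "ell 0 v = 0" "ell v 0 = 0"
  by (simp_all add: ell_def H_0)

lemma ell_uminus [simp]: "ell (- s) v = - ell s v" "ell s (- v) = - ell s v"
  by (simp_all add: ell_def H_uminus)

lemma ell_ssc: "ell (ssc r s) v = ell s (ssc r v)"
  by (simp add: ell_def H_ssc smul_ssc)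

lemma ell_one [simp]: "ell s \<one> = 0"
  by (simp add: ell_def)

text \<open>Expanding \<open>H i 1 \<one> (s \<bullet> t)\<close> with the factorisations s t and (s
  t) 1 and comparing shows that the correction \<open>ell\<close> is the same for every first
  index.\<close>

lemma H_to_0:
  assumes "i < n" "i \<noteq> 0" "shom p s" "shom q t"
  shows "H i 0 s t = ell s t + H i 0 (s \<bullet> t) \<one>"
proof (cases "i = 1")
  case False
  have "H i 1 \<one> (s \<bullet> t) = H i 0 s t - H 1 0 s t"
    using H_jacobi[of i 1 0 False "\<one>" p s q t] assms False by simp
  moreover have "H i 1 \<one> (s \<bullet> t) = H i 0 (s \<bullet> t) \<one> - H 1 0 (s \<bullet> t) \<one>"
    using H_jacobi[of i 1 0 False "\<one>" "p \<noteq> q" "s \<bullet> t" False "\<one>"] assms False shom_smul[OF assms(3,4)] by simp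
  ultimately have "H i 0 s t - H 1 0 s t = H i 0 (s \<bullet> t) \<one> - H 1 0 (s \<bullet> t) \<one>" by simp
  then show ?thesis by (simp add: ell_def algebra_simps)
qed (simp add: ell_def)

lemma H_nonzero:
  assumes "i < n" "j < n" "i \<noteq> j" "i \<noteq> 0" "j \<noteq> 0" "shom p s" "shom q t"
  shows "H i j s t = H i 0 (s \<bullet> t) \<one> - ssign p q (H j 0 t s)"
  using H_jacobi[of i j 0 p s q t False "\<one>"] assms by simp

text \<open>\<open>H 1 2 s (t \<bullet> v)\<close> is expanded through index 0 twice, once splitting
  t v into its factors and once as (t v) 1. After \<open>H_to_0\<close> the terms with second
  argument \<one> cancel by associativity.\<close>

lemma ell_mult:
  assumes "shom p s" "shom q t" "shom r v"
  shows "ell t (v \<bullet> s) = ell (t \<bullet> v) s + ssign p (q \<noteq> r) (ell (s \<bullet> t) v)"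
proof -
  note hom = assms shom_smul[OF assms(2,3)] shom_smul[OF assms(3,1)] shom_smul[OF assms(1,2)]
  have 1: "H 1 2 s (t \<bullet> v) = H 1 0 (s \<bullet> t) v - ssign p (q \<noteq> r) (H 2 0 t (v \<bullet> s))"
    using H_jacobi[of 1 2 0 p s q t r v] hom by simp
  have 2: "H 1 2 s (t \<bullet> v) = H 1 0 (s \<bullet> (t \<bullet> v)) \<one> - ssign p (q \<noteq> r) (H 2 0 (t \<bullet> v) s)"
    by (rule H_nonzero) (use hom in auto)
  have 3: "H 1 0 (s \<bullet> t) v = ell (s \<bullet> t) v + H 1 0 (s \<bullet> t \<bullet> v) \<one>"
    "H 2 0 t (v \<bullet> s) = ell t (v \<bullet> s) + H 2 0 (t \<bullet> (v \<bullet> s)) \<one>"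
    "H 2 0 (t \<bullet> v) s = ell (t \<bullet> v) s + H 2 0 (t \<bullet> v \<bullet> s) \<one>"
    by (rule H_to_0[OF _ _ hom(6,3)] H_to_0[OF _ _ hom(2,5)] H_to_0[OF _ _ hom(4,1)]; simp)+
  show ?thesis
    using trans[OF 1[symmetric] 2] unfolding 3 smul_assoc
    by (cases p; cases q; cases r; simp add: algebra_simps)
qed

text \<open>\<open>H 1 2 s \<one>\<close> and \<open>H 2 1 \<one> s\<close> are opposite, and both
  expand through index 0. The expansions differ only by \<open>ell \<one> s\<close>.\<close>

lemma ell_one_left_hom:
  assumes "shom p s" shows "ell \<one> s = 0"
proof -
  have "H 1 2 s \<one> = H 1 0 s \<one> - H 2 0 \<one> s"
    using H_nonzero[of 1 2 p s False "\<one>"] assms by simp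
  moreover have "H 2 1 \<one> s = H 2 0 s \<one> - H 1 0 s \<one>"
    using H_nonzero[of 2 1 False "\<one>" p s] assms by simp
  moreover have "H 2 1 \<one> s = - H 1 2 s \<one>"
    using H_swap[of 1 2 p s False "\<one>"] assms by simp
  moreover have "H 2 0 \<one> s = ell \<one> s + H 2 0 s \<one>"
    using H_to_0[of 2 False "\<one>" p s] assms by simp
  ultimately show ?thesis by (simp add: algebra_simps)
qed

text \<open>The case of \<open>ell_mult\<close> in which the middle element is \<one>, whose left
  side vanishes.\<close>

lemma ell_swap:
  assumes "shom p s" "shom q t" shows "ell t s = - ssign p q (ell s t)"
  using ell_mult[OF assms(1) _ assms(2), of False "\<one>"] ell_one_left_hom[OF shom_smul[OF assms(2,1)]]
  by (simp add: eq_neg_iff_add_eq_0)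

subsection \<open>Separating the two components of $S$\<close>

abbreviation "\<omega> \<equiv> (0, e)"

lemma pair_split: "(a, b) = (a, 0) + (0, b)" for a b :: 'r
  by simp

lemma ell_pairs: "ell (a + b, 0) s = ell (a, 0) s + ell (b, 0) s" "ell (0, a + b) s = ell (0, a) s + ell (0, b) s"
  "ell s (a + b, 0) = ell s (a, 0) + ell s (b, 0)" "ell s (0, a + b) = ell s (0, a) + ell s (0, b)"
  using ell_add(1)[of "(a, 0)" "(b, 0)" s] ell_add(1)[of "(0, a)" "(0, b)" s]
    ell_add(2)[of s "(a, 0)" "(b, 0)"] ell_add(2)[of s "(0, a)" "(0, b)"] by simp_all

lemma ell_pairs_uminus: "ell (- a, 0) s = - ell (a, 0) s" "ell (0, - a) s = - ell (0, a) s"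
  "ell s (- a, 0) = - ell s (a, 0)" "ell s (0, - a) = - ell s (0, a)"
  using ell_uminus(1)[of "(a, 0)" s] ell_uminus(1)[of "(0, a)" s]
    ell_uminus(2)[of s "(a, 0)"] ell_uminus(2)[of s "(0, a)"] by simp_all

definition gen :: "'r \<Rightarrow> 'r \<Rightarrow> 'v" where
  "gen a b = ell (a, 0) (0, b)"

text \<open>\<open>ell_mult\<close> at \<omega>, a \<omega>, \<omega> has left side
  \<open>ell (0, a) \<one> = 0\<close>, because \<omega> squares to 1. On the right, the products a
  \<omega> \<omega> and \<omega> a \<omega> give a and \<rho>(a), and the signs make the two terms
  add up.\<close>

lemma gen_e_double: assumes "rhom p a" shows "gen a e + gen a e = 0"
proof -
  have "0 = ell ((0, a) \<bullet> \<omega>) \<omega> + ssign True ((\<not> p) \<noteq> True) (ell (\<omega> \<bullet> (0, a)) \<omega>)"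
    using ell_mult[of True \<omega> "\<not> p" "(0, a)" True \<omega>] assms by (simp add: shom_def smul_pairs)
  then show ?thesis
    unfolding smul_pairs rho_hom[OF assms] by (cases p) (simp_all add: gen_def ell_pairs_uminus)
qed

text \<open>The value group may have 2-torsion, so the doubled identity is applied to half of
  \<open>a\<close> instead of being divided.\<close>

lemma gen_e: assumes "rhom p a" shows "gen a e = 0"
  using gen_e_double[OF rhom_sc[OF assms, of u]] by (simp add: gen_def halves flip: ell_pairs(1))

lemma gen_mult:
  assumes "rhom p a" "rhom q b" "rhom r c"
  shows "gen a (b * c) = gen (a * b) c - ssign p (q \<noteq> r) (gen b (c * a))"
proof -
  have hom: "shom p (a, 0)" "shom q (b, 0)" "shom (\<not> r) (0, c)" using assms by (auto simp: shom_def)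
  have 1: "ell (a, 0) (0, b * c) = ell (a * b, 0) (0, c) + ssign (\<not> r) (p \<noteq> q) (ell (0, c * \<rho> a) (b, 0))"
    using ell_mult[OF hom(3,1,2)] by (simp add: smul_pairs)
  have 2: "ell (0, c * \<rho> a) (b, 0) = - ssign q ((\<not> r) \<noteq> p) (ell (b, 0) (0, c * \<rho> a))"
    using ell_swap[OF hom(2) shom_smul[OF hom(3,1)]] by (simp add: smul_pairs)
  show ?thesis
    using 1[unfolded 2, unfolded rho_hom[OF assms(1)]] unfolding gen_def
    by (cases p; cases q; cases r; simp add: ell_pairs_uminus)
qed

text \<open>The case c = e of \<open>gen_mult\<close>.\<close>

lemma gen_antisym: assumes "rhom p a" "rhom q b" shows "gen a b + ssign p q (gen b a) = 0"
  using gen_mult[OF assms rhom_e] gen_e[OF rhom_mult[OF assms]] by simp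

lemma gen_cyclic:
  assumes "rhom p a" "rhom q b" "rhom r c"
  shows "ssign p r (gen (a * b) c) + ssign q p (gen (b * c) a) + ssign r q (gen (c * a) b) = 0"
  using gen_mult[OF assms] gen_antisym[OF assms(1) rhom_mult[OF assms(2,3)]]
    gen_antisym[OF assms(2) rhom_mult[OF assms(3,1)]]
  by (cases p; cases q; cases r; simp add: algebra_simps add_eq_0_iff)

sublocale G: cyclic_form sc e R0 R1 n u gen
proof unfold_locales
  show "gen (sc x a) b = gen a (sc x b)" for x a b
    using ell_ssc[of x "(a, 0)" "(0, b)"] by (simp add: gen_def ssc_def)
qed (simp_all add: gen_antisym gen_cyclic, simp_all add: gen_def ell_pairs)

text \<open>Half of \<open>ell (0, a) \<omega>\<close>, with the halving done inside the argument.
  It turns out to describe \<open>ell\<close> on pairs of the same type as a function of their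
  commutator.\<close>

definition kap :: "'r \<Rightarrow> 'v" where
  "kap a = ell (0, sc u a) \<omega>"

lemma kap_add: "kap (a + b) = kap a + kap b"
  by (simp add: kap_def R.scale_right_distrib ell_pairs)

lemma kap_uminus [simp]: "kap (- a) = - kap a" and kap_0 [simp]: "kap 0 = 0"
  by (simp_all add: kap_def ell_pairs_uminus ell_0[unfolded zero_prod_def])

lemma kap_diff: "kap (a - b) = kap a - kap b"
  using kap_add[of a "- b"] by simp

lemma kap_double: "ell (0, a) \<omega> = kap a + kap a"
  by (simp add: kap_def halves flip: ell_pairs(2))

text \<open>Writing b as (b \<omega>) \<omega> and applying \<open>ell_mult\<close> to \<omega>, a,
  b \<omega> links the pairs without \<omega> to the pairs where both elements carry it.\<close>

lemma ell_even_even_aux: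
  assumes "rhom p a" "rhom q b"
  shows "ell (a, 0) (b, 0) = ell (0, a * b) \<omega> - ssign q True (ell (0, a) (0, b))"
proof -
  have "shom True \<omega>" "shom p (a, 0)" "shom (\<not> q) (0, b)" using assms by (auto simp: shom_def)
  from ell_mult[OF this]
  have "ell (a, 0) (b, 0) = ell (0, a * b) \<omega> + ssign True (p \<noteq> (\<not> q)) (ell (0, \<rho> a) (0, b))"
    by (simp add: smul_pairs)
  then show ?thesis
    unfolding rho_hom[OF assms(1)] by (cases p; cases q; simp add: ell_pairs_uminus)
qed

text \<open>After antisymmetrising the previous identity in a and b, the terms with \<omega> on both
  sides cancel by \<open>ell_swap\<close>.\<close>

lemma ell_even_even_double:
  assumes "rhom p a" "rhom q b"
  shows "ell (a, 0) (b, 0) + ell (a, 0) (b, 0) = ell (0, a * b) \<omega> - ssign p q (ell (0, b * a) \<omega>)"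
proof -
  have "ell (a, 0) (b, 0) = - ssign q p (ell (b, 0) (a, 0))"
    by (rule ell_swap[OF shom_pair(1)[OF assms(2)] shom_pair(1)[OF assms(1)]])
  then have "ell (a, 0) (b, 0) + ell (a, 0) (b, 0) = ell (a, 0) (b, 0) - ssign q p (ell (b, 0) (a, 0))"
    by simp
  also have "\<dots> = ell (0, a * b) \<omega> - ssign p q (ell (0, b * a) \<omega>)"
    unfolding ell_even_even_aux[OF assms] ell_even_even_aux[OF assms(2,1)]
      ell_swap[OF shom_pair(2)[OF assms(1)] shom_pair(2)[OF assms(2)]]
    by (cases p; cases q; simp)
  finally show ?thesis .
qed

lemma ell_even_even:
  assumes "rhom p a" "rhom q b"
  shows "ell (a, 0) (b, 0) = kap (a * b - ssign p q (b * a))"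
proof -
  have "ell (a, 0) (b, 0) = ell (sc u a, 0) (b, 0) + ell (sc u a, 0) (b, 0)"
    by (simp add: halves flip: ell_pairs(1))
  also have "\<dots> = ell (0, sc u a * b) \<omega> - ssign p q (ell (0, b * sc u a) \<omega>)"
    by (rule ell_even_even_double[OF rhom_sc[OF assms(1)] assms(2)])
  also have "\<dots> = kap (a * b) - ssign p q (kap (b * a))"
    by (simp add: kap_def flip: sc_mult)
  finally show ?thesis by (cases p; cases q; simp add: kap_diff kap_add)
qed

lemma ell_odd_odd:
  assumes "rhom p a" "rhom q b"
  shows "ell (0, a) (0, b) = kap (a * \<rho> b - ssign (\<not> p) (\<not> q) (b * \<rho> a))"
  using ell_even_even_aux[OF assms]
  unfolding ell_even_even[OF assms] kap_double rho_hom[OF assms(1)] rho_hom[OF assms(2)]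
  by (cases p; cases q; simp add: kap_diff kap_add algebra_simps add_eq_0_iff)

text \<open>Of the four component pairs, the two of equal type give \<open>kap\<close> of the
  commutator, and the two mixed ones give \<open>gen\<close>. Swapping (b, a' \<omega>) into place
  produces the \<rho> in \<open>odd_form\<close>.\<close>

theorem ell_eq:
  assumes "shom p s" "shom q t"
  shows "ell s t = kap (fst (s \<bullet> t - ssign p q (t \<bullet> s))) + odd_form gen s t"
proof -
  obtain a a' b b' where st: "s = (a, a')" "t = (b, b')" by (metis surj_pair)
  have h: "rhom p a" "rhom (\<not> p) a'" "rhom q b" "rhom (\<not> q) b'"
    using assms by (auto simp: shom_def st)
  have 1: "ell s t = ell (a, 0) (b, 0) + ell (a, 0) (0, b') + ell (0, a') (b, 0) + ell (0, a') (0, b')"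
    unfolding st pair_split[of a a'] pair_split[of b b'] ell_add by (simp only: ac_simps)
  have 2: "ell (a, 0) (0, b') = gen a b'" by (simp add: gen_def)
  have 3: "ell (0, a') (b, 0) = gen a' (\<rho> b)"
  proof -
    have "ell (0, a') (b, 0) = - ssign q p (gen b a')"
      using ell_swap[OF shom_pair(1)[OF h(3)] shom_pair(2)[OF h(2)]] by (simp add: gen_def)
    moreover have "gen b a' = - ssign (\<not> p) q (gen a' b)" by (rule G.lam_swap[OF h(2,3)])
    ultimately show ?thesis unfolding rho_hom[OF h(3)] by (cases p; cases q; simp)
  qed
  have 4: "fst (s \<bullet> t - ssign p q (t \<bullet> s)) = (a * b - ssign p q (b * a)) + (a' * \<rho> b' - ssign p q (b' * \<rho> a'))"
    by (simp add: st smul_def ssign_def algebra_simps)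
  have 5: "ell (0, a') (0, b') = kap (a' * \<rho> b' - ssign p q (b' * \<rho> a'))"
    using ell_odd_odd[OF h(2,4)] by simp
  show ?thesis
    unfolding 1 4 unfolding 2 3 5 ell_even_even[OF h(1,3)] kap_add odd_form_def st fst_conv snd_conv
    by (simp only: ac_simps)
qed

end

context lie_form
begin

subsection \<open>The splitting\<close>

text \<open>This lifts \<open>M\<close> along the bracket up to the \<open>\<omega>\<close>-component of the trace of \<open>M\<close>, which is
  ignored: only additivity is needed to conclude that it vanishes on cycles.\<close>

definition section_map :: "'r mat \<Rightarrow> 'v" where
  "section_map M = (\<Sum>i<n. \<Sum>j<n. if i = j then 0 else bet (elem i i \<one>) (elem i j (ent M i j)))
     + (\<Sum>i\<in>{1..<n}. H i 0 (ent M i i) \<one>) + kap (fst (\<Sum>i<n. ent M i i))"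

lemma section_add: "section_map (M + N) = section_map M + section_map N"
proof -
  have "(\<Sum>i<n. \<Sum>j<n. if i = j then 0 else bet (elem i i \<one>) (elem i j (ent (M + N) i j)))
      = (\<Sum>i<n. \<Sum>j<n. (if i = j then 0 else bet (elem i i \<one>) (elem i j (ent M i j)))
         + (if i = j then 0 else bet (elem i i \<one>) (elem i j (ent N i j))))"
    by (intro sum.cong refl) (auto simp: elem_simps bet_add)
  moreover have "(\<Sum>i\<in>{1..<n}. H i 0 (ent (M + N) i i) \<one>)
      = (\<Sum>i\<in>{1..<n}. H i 0 (ent M i i) \<one> + H i 0 (ent N i i) \<one>)"
    by (intro sum.cong refl) (auto simp: H_add)
  ultimately show ?thesis
    unfolding section_map_def by (simp add: sum.distrib kap_add algebra_simps)
qed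

sublocale sec: additive section_map
  by unfold_locales (rule section_add)

lemma section_ssign: "section_map (ssign p q M) = ssign p q (section_map M)"
  by (simp add: ssign_def sec.minus)

lemma section_elem:
  assumes "i < n" "j < n"
  shows "section_map (elem i j s) = (if i = j then (if i = 0 then 0 else H i 0 s \<one>) + kap (fst s)
    else bet (elem i i \<one>) (elem i j s))"
proof -
  have "(\<Sum>a<n. \<Sum>b<n. if a = b then 0 else bet (elem a a \<one>) (elem a b (ent (elem i j s) a b)))
      = (\<Sum>a<n. \<Sum>b<n. if a = i then (if b = j then (if i = j then 0 else bet (elem i i \<one>) (elem i j s)) else 0) else 0)"
    by (intro sum.cong refl) (auto simp: ent_elem elem_simps bet_0)
  also have "\<dots> = (\<Sum>a<n. if a = i then (\<Sum>b<n. if b = j then (if i = j then 0 else bet (elem i i \<one>) (elem i j s)) else 0) else 0)"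
    by (intro sum.cong refl) auto
  also have "\<dots> = (if i = j then 0 else bet (elem i i \<one>) (elem i j s))" using assms by simp
  finally have 1: "(\<Sum>a<n. \<Sum>b<n. if a = b then 0 else bet (elem a a \<one>) (elem a b (ent (elem i j s) a b))) = \<dots>" .
  have "(\<Sum>a\<in>{1..<n}. H a 0 (ent (elem i j s) a a) \<one>)
      = (\<Sum>a\<in>{1..<n}. if a = i then (if i = j then H i 0 s \<one> else 0) else 0)"
    by (intro sum.cong refl) (auto simp: ent_elem H_0)
  also have "\<dots> = (if i = j \<and> i \<noteq> 0 then H i 0 s \<one> else 0)" using assms by auto
  finally have 2: "(\<Sum>a\<in>{1..<n}. H a 0 (ent (elem i j s) a a) \<one>) = \<dots>" .
  have "(\<Sum>a<n. ent (elem i j s) a a) = (\<Sum>a<n. if a = i then (if i = j then s else 0) else 0)"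
    by (intro sum.cong refl) (auto simp: ent_elem)
  also have "\<dots> = (if i = j then s else 0)" using assms by simp
  finally have 3: "(\<Sum>a<n. ent (elem i j s) a a) = \<dots>" .
  show ?thesis unfolding section_map_def 1 2 3 by auto
qed

text \<open>The defect of the claimed splitting. It inherits antisymmetry and the cocycle identity,
  so its vanishing propagates from root vectors to brackets of root vectors.\<close>

definition D :: "'r mat \<Rightarrow> 'r mat \<Rightarrow> 'v" where
  "D X Y = bet X Y - section_map (br X Y) - trace_form gen X Y"

lemma D_add: "X \<in> L \<Longrightarrow> Y \<in> L \<Longrightarrow> Z \<in> L \<Longrightarrow> D (X + Y) Z = D X Z + D Y Z"
  "X \<in> L \<Longrightarrow> Y \<in> L \<Longrightarrow> Z \<in> L \<Longrightarrow> D Z (X + Y) = D Z X + D Z Y"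
  by (simp_all add: D_def bet_add br_add section_add G.tf_add)

lemma D_0: "X \<in> L \<Longrightarrow> D X 0 = 0" "X \<in> L \<Longrightarrow> D 0 X = 0"
  using D_add(1)[of 0 0 X] D_add(2)[of 0 0 X] by auto

lemma D_msc: "X \<in> L \<Longrightarrow> Y \<in> L \<Longrightarrow> D (msc sc r X) Y = D X (msc sc r Y)"
  by (simp add: D_def bet_msc br_msc G.tf_msc)

lemma D_swap:
  assumes "X \<in> L" "Y \<in> L" "X \<in> mhom p" "Y \<in> mhom q"
  shows "D Y X = - ssign p q (D X Y)"
  unfolding D_def bet_swap[OF assms] br_antisym[OF assms(3,4)] G.tf_swap[OF assms(3,4)]
  by (cases p; cases q; simp add: sec.minus)

text \<open>All three summands satisfy this identity: the form and the trace form as cocycles, and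
  \<open>section_map\<close> of the bracket as a coboundary, by the Jacobi identity.\<close>

lemma D_br:
  assumes "X \<in> L" "Y \<in> L" "Z \<in> L" "X \<in> mhom p" "Y \<in> mhom q" "Z \<in> mhom r"
  shows "D (br X Y) Z = D X (br Y Z) - ssign p q (D Y (br X Z))"
proof -
  have Q: "X \<in> Q" "Y \<in> Q" "Z \<in> Q" using assms L_sub_Q by auto
  have "br (br X Y) Z = br X (br Y Z) - ssign p q (br Y (br X Z))"
    using br_jacobi[OF assms(4-6)] by simp
  then have "section_map (br (br X Y) Z) = section_map (br X (br Y Z)) - ssign p q (section_map (br Y (br X Z)))"
    by (simp only: sec.diff section_ssign)
  then show ?thesis
    unfolding D_def bet_br[OF assms] G.tf_br[OF assms(4-6) Q] by (cases "p \<and> q") (auto simp: ssign_def)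
qed

text \<open>The torus element \<open>h\<close> acts on \<open>bet x y\<close> by the sum of the weights of \<open>x\<close> and \<open>y\<close>,
  and that action is \<open>bet h (br x y)\<close>.\<close>

lemma bet_torus:
  assumes "k < n" "X \<in> L" "Y \<in> L" "X \<in> mhom p" "Y \<in> mhom q"
  shows "bet (elem k k \<one>) (br X Y) = bet (br (elem k k \<one>) X) Y + bet X (br (elem k k \<one>) Y)"
  using bet_jacobi[of "elem k k \<one>" X Y False p q] assms by (simp add: elem_mhom)

lemma br_torus:
  assumes "shom p s" "k < n" "i < n" "j < n"
  shows "br (elem k k \<one>) (elem i j s) = (if k = i then elem i j s else 0) - (if k = j then elem i j s else 0)"
  using assms br_elem[of False "\<one>" p s k k i j] by auto

text \<open>The one place where the cyclic part contributes. The value of the form is computed by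
  \<open>H_to_0\<close> and \<open>ell_eq\<close>: its terms \<open>H a 0 _ \<one>\<close> and
  \<open>kap\<close> are what \<open>section_map\<close> assigns to the diagonal bracket, and the
  remaining \<open>odd_form\<close> is the trace form.\<close>

lemma D_opposite:
  assumes "i < n" "j < n" "i \<noteq> j" "shom p s" "shom q t"
  shows "D (elem i j s) (elem j i t) = 0"
proof -
  have br: "br (elem a b v) (elem b a w) = elem a a (v \<bullet> w) - ssign r r' (elem b b (w \<bullet> v))"
    if "a < n" "b < n" "a \<noteq> b" "shom r v" "shom r' w" for a b r r' v w
    using br_elem[OF that(4,5), of a b b a] that by simp
  have tf: "trace_form gen (elem a b v) (elem b a w) = odd_form gen v w" if "a < n" "b < n" for a b v w
    using that by (simp add: G.tf_elem)
  have zero: "D (elem a 0 v) (elem 0 a w) = 0" if a: "a < n" "a \<noteq> 0" and hom: "shom r v" "shom r' w" for a r r' v w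
  proof -
    have b: "bet (elem a 0 v) (elem 0 a w) = H a 0 v w" by (simp add: H_def)
    show ?thesis
      unfolding D_def b br[OF a(1) idx(1) a(2) hom] tf[OF a(1) idx(1)] sec.diff section_ssign
        section_elem[OF a(1) a(1)] section_elem[OF idx(1) idx(1)] H_to_0[OF a hom] ell_eq[OF hom]
      using a by (cases r; cases r'; simp add: kap_diff kap_add)
  qed
  consider "i \<noteq> 0" "j = 0" | "i = 0" "j \<noteq> 0" | "i \<noteq> 0" "j \<noteq> 0" using assms(3) by auto
  then show ?thesis
  proof cases
    case 1
    then show ?thesis using zero assms by simp
  next
    case 2
    have "D (elem i j s) (elem j i t) = - ssign q p (D (elem j i t) (elem i j s))"
      by (rule D_swap) (use assms in \<open>auto simp: elem_mhom\<close>)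
    then show ?thesis using zero[of j q t p s] 2 assms by simp
  next
    case 3
    have b: "bet (elem i j s) (elem j i t) = H i j s t" by (simp add: H_def)
    \<comment> \<open>Both indices are traded for the base index 0. The correction arrives as
      \<open>ell t s\<close>, and antisymmetry turns its signed value into
      \<open>ell s t\<close>.\<close>
    have "H i j s t = H i 0 (s \<bullet> t) \<one> - ssign p q (ell t s + H j 0 (t \<bullet> s) \<one>)"
      using H_nonzero[of i j p s q t] H_to_0[of j q t p s] 3 assms by simp
    then have c: "H i j s t = H i 0 (s \<bullet> t) \<one> - ssign p q (H j 0 (t \<bullet> s) \<one>)
        + (kap (fst (s \<bullet> t - ssign p q (t \<bullet> s))) + odd_form gen s t)"
      unfolding ell_eq[OF assms(4,5), symmetric] using ell_swap[OF assms(4,5)]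
      by (cases p; cases q; simp)
    show ?thesis
      unfolding D_def b br[OF assms] tf[OF assms(1,2)] sec.diff section_ssign
        section_elem[OF assms(1,1)] section_elem[OF assms(2,2)] c
      using 3 by (cases p; cases q; simp add: kap_diff kap_add)
  qed
qed

text \<open>Opposite roots are done. Otherwise the trace form vanishes and the torus action
  determines the value of the form.\<close>

lemma D_root_root:
  assumes ij: "i < n" "j < n" "i \<noteq> j" and kl: "k < n" "l < n" "k \<noteq> l" and hom: "shom p s" "shom q t"
  shows "D (elem i j s) (elem k l t) = 0"
proof -
  \<comment> \<open>e_aa acts by 1 on e_ab and by 0 on e_bc, so the value on the pair equals the
    value on e_aa and the bracket, which is the choice made in \<open>section_map\<close>.\<close>
  have composable: "D (elem a b v) (elem b c w) = 0"
    if "a < n" "b < n" "c < n" "a \<noteq> b" "b \<noteq> c" "a \<noteq> c" "shom r v" "shom r' w" for a b c r r' v w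
  proof -
    have 1: "br (elem a b v) (elem b c w) = elem a c (v \<bullet> w)"
      using br_elem[OF that(7,8), of a b b c] that by simp
    have "bet (elem a a \<one>) (elem a c (v \<bullet> w)) = bet (elem a b v) (elem b c w)"
      using bet_torus[of a "elem a b v" "elem b c w" r r'] br_torus[OF that(7), of a a b] br_torus[OF that(8), of a b c] that
      by (simp add: elem_mhom 1 bet_0)
    then show ?thesis using that by (simp add: D_def 1 section_elem G.tf_elem)
  qed
  consider "j = k" "i = l" | "j = k" "i \<noteq> l" | "j \<noteq> k" "i = l" | "j \<noteq> k" "i \<noteq> l" by blast
  then show ?thesis
  proof cases
    case 1
    then show ?thesis using D_opposite[OF ij hom] by simp
  next
    case 2
    then show ?thesis using composable[of i j l p s q t] ij kl hom by simp
  next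
    case 3
    have "D (elem i j s) (elem k l t) = - ssign q p (D (elem k l t) (elem i j s))"
      by (rule D_swap) (use ij kl hom in \<open>auto simp: elem_mhom\<close>)
    then show ?thesis using composable[of k i j q t p s] ij kl hom 3 by simp
  next
    case 4
    have br0: "br (elem i j v) (elem k l t) = 0" if "shom p v" for v
      using br_elem[OF that hom(2), of i j k l] ij kl 4 by simp
    have torus: "bet (br (elem m m \<one>) (elem i j v)) (elem k l t) + bet (elem i j v) (br (elem m m \<one>) (elem k l t)) = 0"
      if "m < n" "shom p v" for m v
      using bet_torus[of m "elem i j v" "elem k l t" p q] that ij kl hom by (simp add: br0 elem_mhom bet_0)
    have "bet (elem i j s) (elem k l t) = 0"
    proof -
      \<comment> \<open>The bracket is zero, so a torus element acting with invertible total weight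
        kills the value. In the three cases e_ii, e_jj and e_ii act with total weight 1, -1 and
        2.\<close>
      consider "i \<noteq> k" | "i = k" "j \<noteq> l" | "i = k" "j = l" by blast
      then show ?thesis
      proof cases
        case 1
        then show ?thesis
          using torus[OF ij(1) hom(1)] ij kl 4 hom by (simp add: br_torus[of p] br_torus[of q] bet_0)
      next
        case 2
        then show ?thesis
          using torus[OF ij(2) hom(1)] ij kl 4 hom by (simp add: br_torus[of p] br_torus[of q] bet_0 bet_uminus)
      next
        case 3
        \<comment> \<open>Weight 2 only yields a doubled value. Proving this for every
          \<open>v\<close> lets half of \<open>s\<close> be inserted below.\<close>
        have "bet (elem i j v) (elem k l t) + bet (elem i j v) (elem k l t) = 0" if "shom p v" for v
          using torus[OF ij(1) that] ij kl 3 hom that by (simp add: br_torus[of p] br_torus[of q])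
        from this[OF shom_ssc[OF hom(1), of u]]
        have "bet (elem i j (ssc u s + ssc u s)) (elem k l t) = 0"
          using ij kl by (simp add: elem_simps(2) bet_add)
        then show ?thesis by (simp add: ssc_def halves)
      qed
    qed
    then show ?thesis using ij kl 4 hom by (simp add: D_def br0 sec.zero G.tf_elem)
  qed
qed

text \<open>Bracketing e_ij with a diagonal matrix gives a multiple e_ij(c). Since e_ii acts by 1 on
  e_ij and by 0 on the diagonal matrix, the value equals that on e_ii and e_ij(c), as in
  \<open>section_map\<close>.\<close>

lemma D_root_diag:
  assumes ij: "i < n" "j < n" "i \<noteq> j" and kl: "k < n" "l < n" "k \<noteq> l"
    and hom: "shom p s" "shom q t" "shom r v"
  shows "D (elem i j s) (br (elem k l t) (elem l k v)) = 0"
proof -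
  let ?Z = "br (elem k l t) (elem l k v)"
  have Z: "?Z = elem k k (t \<bullet> v) - ssign q r (elem l l (v \<bullet> t))"
    using br_elem[OF hom(2,3), of k l l k] kl by simp
  have ZL: "?Z \<in> L" "?Z \<in> mhom (q \<noteq> r)"
    using br_L[OF elem_Q elem_Q] mhom_br elem_mhom[OF hom(2)] elem_mhom[OF hom(3)] by blast+
  have "\<exists>c. br (elem i j s) (elem m m w) = elem i j c" if "m < n" "shom r' w" for m r' w
    using br_elem[OF hom(1) that(2), of i j m m] that ij
    by (intro exI[of _ "(if j = m then s \<bullet> w else 0) - ssign p r' (if m = i then w \<bullet> s else 0)"])
      (auto simp: elem_simps)
  then obtain c1 c2 where c: "br (elem i j s) (elem k k (t \<bullet> v)) = elem i j c1"
      "br (elem i j s) (elem l l (v \<bullet> t)) = elem i j c2"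
    using kl shom_smul[OF hom(2,3)] shom_smul[OF hom(3,2)] by metis
  have xz: "br (elem i j s) ?Z = elem i j (c1 - ssign q r c2)"
    unfolding Z by (simp add: br_diff br_ssign c elem_simps)
  have hz: "br (elem i i \<one>) ?Z = 0"
    unfolding Z br_diff br_ssign using ij kl shom_smul[OF hom(2,3)] shom_smul[OF hom(3,2)]
    by (auto simp: br_torus[of "q \<noteq> r"] br_torus[of "r \<noteq> q"])
  have "bet (elem i i \<one>) (br (elem i j s) ?Z) = bet (elem i j s) ?Z"
    using bet_torus[of i "elem i j s" ?Z p "q \<noteq> r"] ZL ij hom
    by (simp add: elem_mhom hz br_torus[of p] bet_0)
  moreover have "trace_form gen (elem i j s) ?Z = 0"
    unfolding Z using ij kl by (auto simp: G.tf_diff ssign_def G.tf_uminus G.tf_elem)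
  ultimately show ?thesis
    unfolding D_def xz using ij by (simp add: section_elem)
qed

lemma gens_hom:
  assumes "X \<in> root_gens \<union> diag_gens" shows "\<exists>p. X \<in> mhom p \<and> X \<in> L"
proof -
  have "\<exists>p. X \<in> mhom p \<and> X \<in> L" if "X \<in> root_gens"
    using that elem_mhom elem_L unfolding root_gens_def by blast
  moreover have "\<exists>p. X \<in> mhom p \<and> X \<in> L" if X: "X \<in> diag_gens"
  proof -
    obtain i j s t p q where "X = br (elem i j s) (elem j i t)" "shom p s" "shom q t"
      using X unfolding diag_gens_def by blast
    then show ?thesis
      using elem_mhom br_L[OF elem_Q elem_Q] mhom_br by metis
  qed
  ultimately show ?thesis using assms by blast
qed

lemma D_root:
  assumes "i < n" "j < n" "i \<noteq> j" "Y \<in> L"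
  shows "D (elem i j s) Y = 0"
proof -
  \<comment> \<open>All \<open>s\<close> are taken at once because \<open>D\<close> is not linear:
    closure under scalars holds by moving the scalar from \<open>Y\<close> into
    \<open>s\<close>.\<close>
  let ?K = "{Y \<in> L. \<forall>s. D (elem i j s) Y = 0}"
  have "M.subspace ?K"
    unfolding M.subspace_def
  proof (intro conjI ballI allI)
    fix r Y assume "Y \<in> ?K"
    moreover have "D (elem i j s) (msc sc r Y) = D (elem i j (ssc r s)) Y" if "Y \<in> L" for s
      using D_msc[of "elem i j s" Y r] assms that by (simp add: elem_simps)
    ultimately show "msc sc r Y \<in> ?K" by (simp del: split_paired_All)
  qed (use assms in \<open>auto simp: D_add D_0\<close>)
  moreover have "Y \<in> ?K" if Y: "Y \<in> root_gens \<union> diag_gens" for Y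
  proof -
    have YL: "Y \<in> L" using gens_hom[OF Y] by blast
    have "D (elem i j s) Y = 0" for s
    proof (induction s rule: shom_induct)
      case (hom p s)
      then show ?case
        using Y D_root_root[OF assms(1-3)] D_root_diag[OF assms(1-3)]
        unfolding root_gens_def diag_gens_def by blast
    next
      case (add s t)
      moreover have "D (elem i j s + elem i j t) Y = D (elem i j s) Y + D (elem i j t) Y"
        using D_add(1) elem_L assms YL by blast
      ultimately show ?case unfolding elem_simps(2) by (simp only: add_0)
    qed
    then show ?thesis using YL by simp
  qed
  ultimately show ?thesis using M.kspan_minimal[of ?K] L_generated assms by blast
qed

text \<open>A diagonal generator is a bracket of root vectors, so \<open>D_br\<close> reduces it to
  \<open>D_root\<close>.\<close>

theorem bet_splits:
  assumes "X \<in> L" "Y \<in> L"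
  shows "bet X Y = section_map (br X Y) + trace_form gen X Y"
proof -
  let ?K = "{X \<in> L. \<forall>Y\<in>L. D X Y = 0}"
  have "M.subspace ?K"
    unfolding M.subspace_def by (auto simp: D_add D_0 D_msc)
  moreover have "X \<in> ?K" if X: "X \<in> root_gens \<union> diag_gens" for X
  proof -
    have XL: "X \<in> L" using gens_hom[OF X] by blast
    \<comment> \<open>The scalar multiples of \<open>X\<close> are included so that this set is
      closed under scalars acting on \<open>Y\<close>.\<close>
    let ?K' = "{Y \<in> L. \<forall>r. D (msc sc r X) Y = 0}"
    have "M.subspace ?K'"
      unfolding M.subspace_def
    proof (intro conjI ballI allI)
      fix r Y assume "Y \<in> ?K'"
      moreover have "D (msc sc c X) (msc sc r Y) = D (msc sc (r * c) X) Y" if "Y \<in> L" for c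
        using D_msc[of "msc sc c X" Y r] XL that by simp
      ultimately show "msc sc r Y \<in> ?K'" by simp
    qed (use XL in \<open>auto simp: D_add D_0\<close>)
    moreover have "Y \<in> ?K'" if Y: "Y \<in> root_gens \<union> diag_gens" for Y
    proof -
      obtain p where Yh: "Y \<in> L" "Y \<in> mhom p" using gens_hom[OF Y] by blast
      have "D (msc sc r X) Y = 0" for r
      proof (cases "X \<in> root_gens")
        case True
        then obtain i j s where "i < n" "j < n" "i \<noteq> j" "X = elem i j s" unfolding root_gens_def by blast
        then show ?thesis using D_root[of i j Y "ssc r s"] Yh by (simp add: elem_simps)
      next
        case False
        then obtain i j s t p' q where ij: "i < n" "j < n" "i \<noteq> j" and st: "shom p' s" "shom q t"
          and X': "X = br (elem i j s) (elem j i t)"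
          using X unfolding diag_gens_def by blast
        have "msc sc r X = br (elem i j (ssc r s)) (elem j i t)" by (simp add: X' elem_simps br_msc)
        moreover have "D (br (elem i j (ssc r s)) (elem j i t)) Y
            = D (elem i j (ssc r s)) (br (elem j i t) Y) - ssign p' q (D (elem j i t) (br (elem i j (ssc r s)) Y))"
          by (rule D_br[where r = p]) (use ij st Yh in \<open>auto simp: elem_mhom shom_ssc\<close>)
        moreover have "br (elem j i t) Y \<in> L" "br (elem i j (ssc r s)) Y \<in> L"
          using br_in_L[of "elem j i t" Y q p] br_in_L[of "elem i j (ssc r s)" Y p' p] ij st Yh
          by (auto simp: elem_mhom shom_ssc)
        ultimately show ?thesis using D_root ij by simp
      qed
      then show ?thesis using Yh by simp
    qed
    ultimately have "L \<subseteq> ?K'" using M.kspan_minimal[of ?K'] L_generated by blast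
    then have "D (msc sc 1 X) Y = 0" if "Y \<in> L" for Y using that by blast
    then show ?thesis using XL by simp
  qed
  ultimately have "L \<subseteq> ?K" using M.kspan_minimal[of ?K] L_generated by blast
  then have "D X Y = 0" using assms by blast
  then show ?thesis by (simp add: D_def algebra_simps)
qed

end

section \<open>The isomorphism\<close>

context queer
begin

abbreviation J1 :: "('r mat \<times> 'r mat \<Rightarrow> 'k) set" where "J1 \<equiv> H2_rels sc R0 R1 n"
abbreviation J2 :: "('r \<times> 'r \<Rightarrow> 'k) set" where "J2 \<equiv> HC1_rels sc R0 R1"

lemma J_subspace: "fsc.subspace J1" "fsc.subspace J2"
  unfolding H2_rels_def HC1_rels_def lam_rels_def by (rule fsc.subspace_kspan)+

lemma hom_L: "hom (L \<inter> mhom False) (L \<inter> mhom True) p X \<longleftrightarrow> X \<in> L \<and> X \<in> mhom p"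
  by (simp add: hom_def)

lemma character_ssign: "additive \<chi> \<Longrightarrow> \<chi> (ssign p q t) = ssign p q (\<chi> t)"
  by (simp add: ssign_def additive.minus)

lemma character_scale_tns:
  assumes "additive \<chi>" "\<And>v. v \<in> J2 \<Longrightarrow> \<chi> v = 0"
  shows "\<chi> (fsc r (tns a b)) = \<chi> (tns (sc r a) b)"
proof -
  have "tns (sc r a) b - fsc r (tns a b) \<in> J2"
    unfolding HC1_rels_def lam_rels_def by (rule kspan.gen) (unfold bilin_rels_def, blast)
  from assms(2)[OF this] show ?thesis by (simp add: additive.diff[OF assms(1)])
qed

lemma character_cyclic_form:
  assumes "additive \<chi>" "\<And>v. v \<in> J2 \<Longrightarrow> \<chi> v = 0"
  shows "cyclic_form sc e R0 R1 n u (\<lambda>a b. \<chi> (tns a b))"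
proof unfold_locales
  note chi = additive.add[OF assms(1)] additive.diff[OF assms(1)] character_ssign[OF assms(1)]
  have gen: "\<chi> t = 0" if "t \<in> bilin_rels UNIV sc \<union> cyc_rels UNIV R0 R1 (*)" for t
    using that assms(2) kspan.gen unfolding HC1_rels_def lam_rels_def by blast
  show "\<chi> (tns (a + b) c) = \<chi> (tns a c) + \<chi> (tns b c)" for a b c
  proof -
    have "\<chi> (tns (a + b) c - tns a c - tns b c) = 0" by (rule gen) (unfold bilin_rels_def, blast)
    then show ?thesis by (simp add: chi algebra_simps)
  qed
  show "\<chi> (tns a (b + c)) = \<chi> (tns a b) + \<chi> (tns a c)" for a b c
  proof -
    have "\<chi> (tns a (b + c) - tns a b - tns a c) = 0" by (rule gen) (unfold bilin_rels_def, blast)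
    then show ?thesis by (simp add: chi algebra_simps)
  qed
  show "\<chi> (tns (sc r a) b) = \<chi> (tns a (sc r b))" for r a b
  proof -
    have "\<chi> (tns (sc r a) b - fsc r (tns a b)) = 0" "\<chi> (tns a (sc r b) - fsc r (tns a b)) = 0"
      by (rule gen; unfold bilin_rels_def, blast)+
    then show ?thesis by (simp add: chi)
  qed
  show "\<chi> (tns a b) + ssign p q (\<chi> (tns b a)) = 0" if "rhom p a" "rhom q b" for p q a b
  proof -
    have "\<chi> (tns a b + fsc (ssign p q 1) (tns b a)) = 0"
      by (rule gen) (use that in \<open>unfold cyc_rels_def, blast\<close>)
    then show ?thesis by (simp add: chi fsc_ssign)
  qed
  show "ssign p r (\<chi> (tns (a * b) c)) + ssign q p (\<chi> (tns (b * c) a)) + ssign r q (\<chi> (tns (c * a) b)) = 0"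
    if "rhom p a" "rhom q b" "rhom r c" for p q r a b c
  proof -
    have "\<chi> (fsc (ssign p r 1) (tns (a * b) c) + fsc (ssign q p 1) (tns (b * c) a)
        + fsc (ssign r q 1) (tns (c * a) b)) = 0"
      by (rule gen) (use that in \<open>unfold cyc_rels_def, blast\<close>)
    then show ?thesis by (simp add: chi fsc_ssign)
  qed
qed

lemma character_scale_tns_L:
  assumes "additive \<chi>" "\<And>v. v \<in> J1 \<Longrightarrow> \<chi> v = 0" "X \<in> L" "Y \<in> L"
  shows "\<chi> (fsc r (tns X Y)) = \<chi> (tns (msc sc r X) Y)"
proof -
  have "tns (msc sc r X) Y - fsc r (tns X Y) \<in> J1"
    unfolding H2_rels_def lam_rels_def
    by (rule kspan.gen) (use assms(3,4) in \<open>unfold bilin_rels_def, blast\<close>)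
  from assms(2)[OF this] show ?thesis by (simp add: additive.diff[OF assms(1)])
qed

lemma character_lie_form:
  assumes "additive \<chi>" "\<And>v. v \<in> J1 \<Longrightarrow> \<chi> v = 0"
  shows "lie_form sc e R0 R1 n u (\<lambda>X Y. \<chi> (tns X Y))"
proof unfold_locales
  note chi = additive.add[OF assms(1)] additive.diff[OF assms(1)] character_ssign[OF assms(1)]
  have gen: "\<chi> t = 0"
    if "t \<in> bilin_rels L (msc sc) \<union> cyc_rels L (L \<inter> mhom False) (L \<inter> mhom True) br" for t
    using that assms(2) kspan.gen unfolding H2_rels_def lam_rels_def by blast
  show "\<chi> (tns (X + Y) Z) = \<chi> (tns X Z) + \<chi> (tns Y Z)" if "X \<in> L" "Y \<in> L" "Z \<in> L" for X Y Z
  proof -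
    have "\<chi> (tns (X + Y) Z - tns X Z - tns Y Z) = 0"
      by (rule gen) (use that in \<open>unfold bilin_rels_def, blast\<close>)
    then show ?thesis by (simp add: chi algebra_simps)
  qed
  show "\<chi> (tns Z (X + Y)) = \<chi> (tns Z X) + \<chi> (tns Z Y)" if "X \<in> L" "Y \<in> L" "Z \<in> L" for X Y Z
  proof -
    have "\<chi> (tns Z (X + Y) - tns Z X - tns Z Y) = 0"
      by (rule gen) (use that in \<open>unfold bilin_rels_def, blast\<close>)
    then show ?thesis by (simp add: chi algebra_simps)
  qed
  show "\<chi> (tns (msc sc r X) Y) = \<chi> (tns X (msc sc r Y))" if "X \<in> L" "Y \<in> L" for r X Y
  proof -
    have "\<chi> (tns (msc sc r X) Y - fsc r (tns X Y)) = 0" "\<chi> (tns X (msc sc r Y) - fsc r (tns X Y)) = 0"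
      by (rule gen; use that in \<open>unfold bilin_rels_def, blast\<close>)+
    then show ?thesis by (simp add: chi)
  qed
  show "\<chi> (tns X Y) + ssign p q (\<chi> (tns Y X)) = 0"
    if "X \<in> L" "Y \<in> L" "X \<in> mhom p" "Y \<in> mhom q" for p q X Y
  proof -
    have "\<chi> (tns X Y + fsc (ssign p q 1) (tns Y X)) = 0"
      by (rule gen, unfold cyc_rels_def hom_L) (use that in blast)
    then show ?thesis by (simp add: chi fsc_ssign)
  qed
  show "ssign p r (\<chi> (tns (br X Y) Z)) + ssign q p (\<chi> (tns (br Y Z) X)) + ssign r q (\<chi> (tns (br Z X) Y)) = 0"
    if "X \<in> L" "Y \<in> L" "Z \<in> L" "X \<in> mhom p" "Y \<in> mhom q" "Z \<in> mhom r" for p q r X Y Z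
  proof -
    have "\<chi> (fsc (ssign p r 1) (tns (br X Y) Z) + fsc (ssign q p 1) (tns (br Y Z) X)
        + fsc (ssign r q 1) (tns (br Z X) Y)) = 0"
      by (rule gen, unfold cyc_rels_def hom_L) (use that in blast)
    then show ?thesis by (simp add: chi fsc_ssign)
  qed
qed

subsection \<open>The map to $\langle R, R\rangle$\<close>

lemma ssign_finsup [simp]: "t \<in> finsup \<Longrightarrow> ssign p q t \<in> finsup"
  by (simp add: ssign_def)

definition to_HC :: "('r mat \<times> 'r mat \<Rightarrow> 'k) \<Rightarrow> ('r \<times> 'r \<Rightarrow> 'k)" where
  "to_HC = lin_ext fsc (trace_form tns)"

lemma trace_form_finsup [simp]: "trace_form tns X Y \<in> finsup"
  unfolding trace_form_def odd_form_def by simp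

lemma to_HC_simps:
  "to_HC 0 = 0" "to_HC (tns X Y) = trace_form tns X Y"
  "s \<in> finsup \<Longrightarrow> t \<in> finsup \<Longrightarrow> to_HC (s + t) = to_HC s + to_HC t"
  "s \<in> finsup \<Longrightarrow> t \<in> finsup \<Longrightarrow> to_HC (s - t) = to_HC s - to_HC t"
  "t \<in> finsup \<Longrightarrow> to_HC (fsc r t) = fsc r (to_HC t)"
  "t \<in> finsup \<Longrightarrow> to_HC (ssign p q t) = ssign p q (to_HC t)"
  unfolding to_HC_def by (simp_all add: fsc.lin_ext_0 fsc.lin_ext_tns fsc.lin_ext_add fsc.lin_ext_diff
      fsc.lin_ext_fsc fsc.lin_ext_minus ssign_def)

lemma character_trace_form:
  assumes "additive \<chi>" "\<And>v. v \<in> J2 \<Longrightarrow> \<chi> v = 0"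
  shows "\<chi> (trace_form tns X Y) = trace_form (\<lambda>a b. \<chi> (tns a b)) X Y"
    and "\<chi> (fsc r (trace_form tns X Y)) = trace_form (\<lambda>a b. \<chi> (tns a b)) (msc sc r X) Y"
  unfolding trace_form_def odd_form_def
  by (simp_all add: additive.sum[OF assms(1)] additive.add[OF assms(1)] fsc.scale_sum_right
      fsc.scale_right_distrib character_scale_tns[OF assms] ssc_def)

text \<open>A character killing \<open>J2\<close> turns the image of each generating relation into
  an identity of its trace form.\<close>

lemma to_HC_rels: assumes "t \<in> J1" shows "to_HC t \<in> J2"
proof -
  let ?G = "bilin_rels L (msc sc) \<union> cyc_rels L (L \<inter> mhom False) (L \<inter> mhom True) br"
  have "to_HC g \<in> J2" if g: "g \<in> ?G" for g
  proof (rule fsc.mem_by_characters[OF J_subspace(2)])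
    fix \<chi> :: "('r \<times> 'r \<Rightarrow> 'k) \<Rightarrow> rat_circle"
    assume chi: "additive \<chi>" "\<And>v. v \<in> J2 \<Longrightarrow> \<chi> v = 0"
    interpret C: cyclic_form sc e R0 R1 n u "\<lambda>a b. \<chi> (tns a b)" by (rule character_cyclic_form[OF chi])
    note simps = to_HC_simps additive.add[OF chi(1)] additive.diff[OF chi(1)] character_ssign[OF chi(1)]
      character_trace_form[OF chi] fsc_ssign C.tf_add C.tf_msc
    show "\<chi> (to_HC g) = 0"
      using g unfolding bilin_rels_def cyc_rels_def hom_L
    proof (elim UnE CollectE exE conjE)
      fix X Y p q assume "g = tns X Y + fsc (ssign p q 1) (tns Y X)" "X \<in> mhom p" "Y \<in> mhom q"
      then show ?thesis using C.tf_swap[of X p Y q] by (simp add: simps)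
    next
      fix X Y Z p q r
      assume "g = fsc (ssign p r 1) (tns (br X Y) Z) + fsc (ssign q p 1) (tns (br Y Z) X)
        + fsc (ssign r q 1) (tns (br Z X) Y)" "X \<in> mhom p" "Y \<in> mhom q" "Z \<in> mhom r" "X \<in> L" "Y \<in> L" "Z \<in> L"
      moreover from this have "X \<in> Q" "Y \<in> Q" "Z \<in> Q" using L_sub_Q by auto
      ultimately show ?thesis using C.tf_br_cyclic[of X p Y q Z r] by (simp add: simps)
    qed (simp_all add: simps)
  qed
  then show ?thesis
    using fsc.lin_ext_kspan[OF J_subspace(2), of ?G "trace_form tns" t] assms
    unfolding to_HC_def H2_rels_def lam_rels_def
    using lam_rels_finsup[of L "msc sc" "L \<inter> mhom False" "L \<inter> mhom True" br] kspan.gen[of _ ?G fsc]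
    unfolding lam_rels_def by blast
qed

subsection \<open>The map back\<close>

text \<open>A representative of \<open>gen a b\<close> in the free module: the formula for
  \<open>ell\<close> with \<open>tns\<close> in place of the form.\<close>

definition gen_free :: "'r \<Rightarrow> 'r \<Rightarrow> ('r mat \<times> 'r mat \<Rightarrow> 'k)" where
  "gen_free a b = tns (elem 1 0 (a, 0)) (elem 0 1 (0, b)) - tns (elem 1 0 ((a, 0) \<bullet> (0, b))) (elem 0 1 \<one>)"

definition from_HC :: "('r \<times> 'r \<Rightarrow> 'k) \<Rightarrow> ('r mat \<times> 'r mat \<Rightarrow> 'k)" where
  "from_HC = lin_ext fsc gen_free"

lemma gen_free_finsup [simp]: "gen_free a b \<in> finsup"
  by (simp add: gen_free_def)

lemma from_HC_simps:
  "from_HC 0 = 0" "from_HC (tns a b) = gen_free a b"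
  "s \<in> finsup \<Longrightarrow> t \<in> finsup \<Longrightarrow> from_HC (s + t) = from_HC s + from_HC t"
  "s \<in> finsup \<Longrightarrow> t \<in> finsup \<Longrightarrow> from_HC (s - t) = from_HC s - from_HC t"
  "t \<in> finsup \<Longrightarrow> from_HC (fsc r t) = fsc r (from_HC t)"
  "t \<in> finsup \<Longrightarrow> from_HC (ssign p q t) = ssign p q (from_HC t)"
  unfolding from_HC_def by (simp_all add: fsc.lin_ext_0 fsc.lin_ext_tns fsc.lin_ext_add fsc.lin_ext_diff
      fsc.lin_ext_fsc fsc.lin_ext_minus ssign_def)

lemma from_HC_sum: "(\<And>i. i \<in> A \<Longrightarrow> f i \<in> finsup) \<Longrightarrow> from_HC (\<Sum>i\<in>A. f i) = (\<Sum>i\<in>A. from_HC (f i))"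
  unfolding from_HC_def by (rule fsc.lin_ext_sum)

lemma character_gen_free:
  assumes "additive \<chi>" "\<And>v. v \<in> J1 \<Longrightarrow> \<chi> v = 0"
  shows "\<chi> (gen_free a b) = lie_form.gen e R0 R1 n (\<lambda>X Y. \<chi> (tns X Y)) a b"
    and "\<chi> (fsc r (gen_free a b)) = lie_form.gen e R0 R1 n (\<lambda>X Y. \<chi> (tns X Y)) (sc r a) b"
proof -
  interpret F: lie_form sc e R0 R1 n u "\<lambda>X Y. \<chi> (tns X Y)" by (rule character_lie_form[OF assms])
  show "\<chi> (gen_free a b) = F.gen a b"
    by (simp add: gen_free_def F.gen_def F.ell_def F.H_def additive.diff[OF assms(1)])
  have "msc sc r (elem 1 0 (a, 0)) = elem 1 0 (sc r a, 0)"
    "msc sc r (elem 1 0 ((a, 0) \<bullet> (0, b))) = elem 1 0 ((sc r a, 0) \<bullet> (0, b))"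
    by (simp_all add: smul_def ssc_def sc_mult flip: elem_simps)
  then show "\<chi> (fsc r (gen_free a b)) = F.gen (sc r a) b"
    by (simp add: gen_free_def F.gen_def F.ell_def F.H_def additive.diff[OF assms(1)]
        fsc.scale_right_diff_distrib character_scale_tns_L[OF assms])
qed

lemma from_HC_rels: assumes "t \<in> J2" shows "from_HC t \<in> J1"
proof -
  let ?G = "bilin_rels UNIV sc \<union> cyc_rels UNIV R0 R1 (*)"
  have "from_HC g \<in> J1" if g: "g \<in> ?G" for g
  proof (rule fsc.mem_by_characters[OF J_subspace(1)])
    fix \<chi> :: "('r mat \<times> 'r mat \<Rightarrow> 'k) \<Rightarrow> rat_circle"
    assume chi: "additive \<chi>" "\<And>v. v \<in> J1 \<Longrightarrow> \<chi> v = 0"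
    interpret F: lie_form sc e R0 R1 n u "\<lambda>X Y. \<chi> (tns X Y)" by (rule character_lie_form[OF chi])
    note simps = from_HC_simps additive.add[OF chi(1)] additive.diff[OF chi(1)] character_ssign[OF chi(1)]
      character_gen_free[OF chi] fsc_ssign F.G.lam_add F.G.lam_sc
    show "\<chi> (from_HC g) = 0"
      using g unfolding bilin_rels_def cyc_rels_def
    proof (elim UnE CollectE exE conjE)
      fix a b p q assume "g = tns a b + fsc (ssign p q 1) (tns b a)" "rhom p a" "rhom q b"
      then show ?thesis using F.gen_antisym[of p a q b] by (simp add: simps)
    next
      fix a b c p q r
      assume "g = fsc (ssign p r 1) (tns (a * b) c) + fsc (ssign q p 1) (tns (b * c) a)
        + fsc (ssign r q 1) (tns (c * a) b)" "rhom p a" "rhom q b" "rhom r c"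
      then show ?thesis using F.gen_cyclic[of p a q b r c] by (simp add: simps)
    qed (simp_all add: simps)
  qed
  then show ?thesis
    using fsc.lin_ext_kspan[OF J_subspace(1), of ?G gen_free t] assms
    unfolding from_HC_def HC1_rels_def lam_rels_def
    using lam_rels_finsup[of UNIV sc R0 R1 "(*)"] kspan.gen[of _ ?G fsc]
    unfolding lam_rels_def by blast
qed

subsection \<open>Boundaries\<close>

abbreviation d1 :: "('r mat \<times> 'r mat \<Rightarrow> 'k) \<Rightarrow> 'r mat" where "d1 \<equiv> lin_ext (msc sc) br"
abbreviation d2 :: "('r \<times> 'r \<Rightarrow> 'k) \<Rightarrow> 'r" where "d2 \<equiv> lin_ext sc (scomm R0 R1 (*))"

text \<open>The parts are formed from the entries over S, which keeps them in
  \<open>Q\<close>.\<close>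

lemma Q_hom_decompose:
  assumes "X \<in> Q"
  shows "\<exists>X0 X1. X0 \<in> Q \<and> X1 \<in> Q \<and> X0 \<in> mhom False \<and> X1 \<in> mhom True \<and> X = X0 + X1"
proof -
  obtain f0 f1 where f: "\<And>s. shom False (f0 s)" "\<And>s. shom True (f1 s)" "\<And>s. s = f0 s + f1 s"
    using shom_decompose by metis
  let ?X = "\<lambda>f. qmat (\<lambda>i j. f (ent X i j))"
  have "X = ?X f0 + ?X f1"
  proof (rule Q_eqI)
    fix i j assume "i < n" "j < n"
    then show "ent X i j = ent (?X f0 + ?X f1) i j" using f(3)[of "ent X i j"] by simp
  qed (use assms in auto)
  then show ?thesis
    using f by (intro exI[of _ "?X f0"] exI[of _ "?X f1"]) (simp add: qmat_mhom)
qed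

text \<open>With the supercommutator of the ring as \<open>lam\<close>, \<open>odd_form\<close> is
  the \<omega>-component of the supercommutator in S.\<close>

lemma odd_form_scomm:
  assumes "shom p s" "shom q t"
  shows "odd_form (scomm R0 R1 (*)) s t = snd (s \<bullet> t) - ssign p q (snd (t \<bullet> s))"
proof -
  have h: "rhom p (fst s)" "rhom (\<not> p) (snd s)" "rhom q (fst t)" "rhom (\<not> q) (snd t)"
    using assms by (auto simp: shom_def)
  show ?thesis
    unfolding odd_form_def R.scomm_hom[OF h(1,4)] R.scomm_hom[OF h(2) rhom_rho[OF h(3)]] smul_def snd_conv
    unfolding rho_hom[OF h(1)] rho_hom[OF h(3)]
    by (cases p; cases q; simp)
qed

lemma snd_sum: "snd (\<Sum>i\<in>A. f i) = (\<Sum>i\<in>A. snd (f i))" for f :: "'i \<Rightarrow> 'r \<times> 'r"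
  by (induction A rule: infinite_finite_induct) auto

text \<open>The trace of the block B, known as the odd or queer trace. It intertwines the two
  boundaries, so cycles map to cycles.\<close>

definition odd_trace :: "'r mat \<Rightarrow> 'r" where
  "odd_trace X = (\<Sum>i<n. snd (ent X i i))"

lemma odd_trace_add: "odd_trace (X + Y) = odd_trace X + odd_trace Y"
  by (simp add: odd_trace_def sum.distrib)

lemma odd_trace_msc: "odd_trace (msc sc r X) = sc r (odd_trace X)"
  by (simp add: odd_trace_def ssc_def R.scale_sum_right)

lemma odd_trace_br_hom:
  assumes "X \<in> Q" "Y \<in> Q" "X \<in> mhom p" "Y \<in> mhom q"
  shows "trace_form (scomm R0 R1 (*)) X Y = odd_trace (br X Y)"
proof -
  have "trace_form (scomm R0 R1 (*)) X Y
      = (\<Sum>i<n. \<Sum>j<n. snd (ent X i j \<bullet> ent Y j i) - ssign p q (snd (ent Y j i \<bullet> ent X i j)))"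
    unfolding trace_form_def by (intro sum.cong refl odd_form_scomm shom_ent assms) auto
  also have "\<dots> = (\<Sum>i<n. \<Sum>j<n. snd (ent X i j \<bullet> ent Y j i))
      - ssign p q (\<Sum>i<n. \<Sum>j<n. snd (ent Y j i \<bullet> ent X i j))"
    by (simp add: sum_subtractf ssign_sum)
  also have "(\<Sum>i<n. \<Sum>j<n. snd (ent Y j i \<bullet> ent X i j)) = (\<Sum>j<n. \<Sum>i<n. snd (ent Y j i \<bullet> ent X i j))"
    by (rule sum.swap)
  also have "(\<Sum>i<n. \<Sum>j<n. snd (ent X i j \<bullet> ent Y j i)) - ssign p q \<dots> = odd_trace (br X Y)"
    unfolding odd_trace_def br_hom[OF assms(3,4)]
    by (simp add: ent_mmul assms snd_sum sum_subtractf sum_negf ssign_def)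
  finally show ?thesis .
qed

lemma odd_form_scomm_add:
  "odd_form (scomm R0 R1 (*)) (s + t) v = odd_form (scomm R0 R1 (*)) s v + odd_form (scomm R0 R1 (*)) t v"
  "odd_form (scomm R0 R1 (*)) v (s + t) = odd_form (scomm R0 R1 (*)) v s + odd_form (scomm R0 R1 (*)) v t"
  by (simp_all add: odd_form_def R.scomm_add_left R.scomm_add_right algebra_simps)

lemma trace_form_scomm_add:
  "trace_form (scomm R0 R1 (*)) (X + Y) Z = trace_form (scomm R0 R1 (*)) X Z + trace_form (scomm R0 R1 (*)) Y Z"
  "trace_form (scomm R0 R1 (*)) Z (X + Y) = trace_form (scomm R0 R1 (*)) Z X + trace_form (scomm R0 R1 (*)) Z Y"
  by (simp_all add: trace_form_def odd_form_scomm_add sum.distrib)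

lemma odd_trace_br:
  assumes "X \<in> Q" "Y \<in> Q"
  shows "trace_form (scomm R0 R1 (*)) X Y = odd_trace (br X Y)"
proof -
  obtain X0 X1 where X: "X0 \<in> Q" "X1 \<in> Q" "X0 \<in> mhom False" "X1 \<in> mhom True" "X = X0 + X1"
    using Q_hom_decompose[OF assms(1)] by blast
  obtain Y0 Y1 where Y: "Y0 \<in> Q" "Y1 \<in> Q" "Y0 \<in> mhom False" "Y1 \<in> mhom True" "Y = Y0 + Y1"
    using Q_hom_decompose[OF assms(2)] by blast
  show ?thesis
    unfolding X(5) Y(5) trace_form_scomm_add br_add odd_trace_add
      odd_trace_br_hom[OF X(1) Y(1) X(3) Y(3)] odd_trace_br_hom[OF X(1) Y(2) X(3) Y(4)]
      odd_trace_br_hom[OF X(2) Y(1) X(4) Y(3)] odd_trace_br_hom[OF X(2) Y(2) X(4) Y(4)] ..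
qed

lemma d2_trace_form: "d2 (trace_form tns X Y) = trace_form (scomm R0 R1 (*)) X Y"
  unfolding trace_form_def odd_form_def
  by (simp add: R.lin_ext_sum R.lin_ext_add R.lin_ext_tns)

lemma d2_to_HC:
  assumes "t \<in> pairs_mod L" shows "d2 (to_HC t) = odd_trace (d1 t)" and "to_HC t \<in> finsup"
proof -
  have zero': "0 \<in> finsup \<and> to_HC 0 \<in> finsup \<and> d2 (to_HC 0) = odd_trace (d1 0)"
    unfolding to_HC_simps R.lin_ext_0 M.lin_ext_0 by (simp add: odd_trace_def)
  have "t \<in> finsup \<and> to_HC t \<in> finsup \<and> d2 (to_HC t) = odd_trace (d1 t)"
    using assms unfolding pairs_mod_def
  proof induction
    case zero
    show ?case by (rule zero')
  next
    case (gen g)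
    then obtain X Y where "g = tns X Y" "X \<in> Q" "Y \<in> Q" using L_sub_Q by blast
    then show ?case by (simp add: to_HC_simps d2_trace_form odd_trace_br M.lin_ext_tns)
  next
    case (add s t)
    then show ?case by (simp add: to_HC_simps R.lin_ext_add M.lin_ext_add odd_trace_add del: plus_fun_apply)
  next
    case (smul t r)
    then show ?case by (simp add: to_HC_simps R.lin_ext_fsc M.lin_ext_fsc odd_trace_msc)
  qed
  then show "d2 (to_HC t) = odd_trace (d1 t)" "to_HC t \<in> finsup" by auto
qed

lemma elem_pair_add: "elem i j (0, a + b) = elem i j (0, a) + elem i j (0, b)"
  "elem i j (a + b, 0) = elem i j (a, 0) + elem i j (b, 0)"
  using elem_simps(2)[of i j "(0, a)" "(0, b)"] elem_simps(2)[of i j "(a, 0)" "(b, 0)"] by simp_all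

text \<open>The correction term in \<open>gen_free\<close> cancels the entry at (1, 1), and the two
  entries at (0, 0) combine to the commutator times \<omega>.\<close>

lemma d1_gen_free: "d1 (gen_free a b) = elem 0 0 (0, scomm R0 R1 (*) a b)"
proof -
  note sm = smul_pairs(2)
  have "br (elem 1 0 (a, 0)) (elem 0 1 (0, b)) - br (elem 1 0 (0, a * b)) (elem 0 1 \<one>)
      = elem 0 0 (0, scomm R0 R1 (*) a b)"
  proof (induction a rule: R.hom_induct)
    case a: (hom p a)
    show ?case
    proof (induction b rule: R.hom_induct)
      case b: (hom q b)
      note h = shom_pair(1)[OF a] shom_pair(2)[OF b]
      have 1: "br (elem 1 0 (a, 0)) (elem 0 1 (0, b))
          = elem 1 1 ((a, 0) \<bullet> (0, b)) - ssign p (\<not> q) (elem 0 0 ((0, b) \<bullet> (a, 0)))"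
        using br_elem[OF h, of 1 0 0 1] by simp
      have 2: "br (elem 1 0 ((a, 0) \<bullet> (0, b))) (elem 0 1 \<one>)
          = elem 1 1 ((a, 0) \<bullet> (0, b)) - elem 0 0 ((a, 0) \<bullet> (0, b))"
        using br_elem[OF shom_smul[OF h] shom_simps(2), of 1 0 0 1] by simp
      have "(0, scomm R0 R1 (*) a b) = (a, 0) \<bullet> (0, b) - ssign p (\<not> q) ((0, b) \<bullet> (a, 0))"
        unfolding R.scomm_hom[OF a b] smul_def
        by (cases p; cases q) (simp_all add: rho_hom[OF a])
      then show ?case unfolding 1 2[unfolded sm] sm by (simp only: elem_simps) (simp add: algebra_simps)
    next
      case (add b c)
      then show ?case
        unfolding R.scomm_add_right distrib_left elem_pair_add br_add by (simp only: algebra_simps)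
    qed
  next
    case (add a c)
    then show ?case
      unfolding R.scomm_add_left distrib_right elem_pair_add br_add by (simp only: algebra_simps)
  qed
  then show ?thesis by (simp add: gen_free_def M.lin_ext_diff M.lin_ext_tns sm)
qed

lemma from_HC_pairs:
  assumes "t \<in> pairs_mod UNIV"
  shows "d1 (from_HC t) = elem 0 0 (0, d2 t)" "from_HC t \<in> pairs_mod L"
proof -
  have sub: "fsc.subspace (pairs_mod L)" unfolding pairs_mod_def by (rule fsc.subspace_kspan)
  have tns: "tns X Y \<in> pairs_mod L" if "X \<in> L" "Y \<in> L" for X Y
    unfolding pairs_mod_def by (rule kspan.gen) (use that in blast)
  have zero': "0 \<in> finsup \<and> from_HC 0 \<in> finsup \<and> d1 (from_HC 0) = elem 0 0 (0, d2 0) \<and> from_HC 0 \<in> pairs_mod L"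
    unfolding from_HC_simps R.lin_ext_0 M.lin_ext_0 using fsc.subspace_0[OF sub] elem_simps(1)[of 0 0]
    by (simp add: zero_prod_def)
  have "t \<in> finsup \<and> from_HC t \<in> finsup \<and> d1 (from_HC t) = elem 0 0 (0, d2 t) \<and> from_HC t \<in> pairs_mod L"
    using assms unfolding pairs_mod_def[of UNIV]
  proof induction
    case zero
    show ?case by (rule zero')
  next
    case (gen g)
    then obtain a b where "g = tns a b" by blast
    then show ?case
      by (simp add: from_HC_simps d1_gen_free R.lin_ext_tns)
        (simp add: gen_free_def fsc.subspace_diff[OF sub] tns)
  next
    case (add s t)
    then show ?case
      by (simp add: from_HC_simps R.lin_ext_add M.lin_ext_add fsc.subspace_add[OF sub] elem_pair_add
          del: plus_fun_apply)
  next
    case (smul t r)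
    have "(0, sc r b) = ssc r (0, b)" for b by (simp add: ssc_def)
    with smul show ?case
      by (simp add: from_HC_simps R.lin_ext_fsc M.lin_ext_fsc fsc.subspace_scale[OF sub] elem_simps)
  qed
  then show "d1 (from_HC t) = elem 0 0 (0, d2 t)" "from_HC t \<in> pairs_mod L" by auto
qed

subsection \<open>The two maps are mutually inverse\<close>

text \<open>On a generator, the first tensor of \<open>gen_free\<close> has trace value
  \<open>lam a b\<close>, and the correction contributes \<open>lam (a * b) e\<close>, which is zero
  by \<open>lam_e\<close>.\<close>

lemma to_from_HC:
  assumes "t \<in> pairs_mod UNIV" shows "to_HC (from_HC t) - t \<in> J2"
proof -
  note J = fsc.subspace_add[OF J_subspace(2)] fsc.subspace_scale[OF J_subspace(2)] fsc.subspace_0[OF J_subspace(2)]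
  have gen: "to_HC (gen_free a b) - tns a b \<in> J2" for a b
  proof (rule fsc.mem_by_characters[OF J_subspace(2)])
    fix \<chi> :: "('r \<times> 'r \<Rightarrow> 'k) \<Rightarrow> rat_circle"
    assume chi: "additive \<chi>" "\<And>v. v \<in> J2 \<Longrightarrow> \<chi> v = 0"
    interpret C: cyclic_form sc e R0 R1 n u "\<lambda>a b. \<chi> (tns a b)" by (rule character_cyclic_form[OF chi])
    show "\<chi> (to_HC (gen_free a b) - tns a b) = 0"
      by (simp add: gen_free_def to_HC_simps additive.diff[OF chi(1)] character_trace_form[OF chi] C.tf_elem
          odd_form_def smul_def C.lam_e)
  qed
  let ?K = "{t \<in> finsup. from_HC t \<in> finsup \<and> to_HC (from_HC t) - t \<in> J2}"
  have "fsc.subspace ?K"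
    unfolding fsc.subspace_def
  proof (intro conjI ballI allI)
    show "0 \<in> ?K" by (simp add: from_HC_simps to_HC_simps J)
  next
    fix s t assume st: "s \<in> ?K" "t \<in> ?K"
    then have "(to_HC (from_HC s) - s) + (to_HC (from_HC t) - t) \<in> J2" by (intro J) auto
    with st show "s + t \<in> ?K" by (simp add: from_HC_simps to_HC_simps algebra_simps)
  next
    fix r t assume t: "t \<in> ?K"
    then have "fsc r (to_HC (from_HC t) - t) \<in> J2" by (intro J) auto
    with t show "fsc r t \<in> ?K" by (simp add: from_HC_simps to_HC_simps fsc.scale_right_diff_distrib)
  qed
  moreover have "{tns a b | a b. a \<in> UNIV \<and> b \<in> UNIV} \<subseteq> ?K" using gen by (auto simp: from_HC_simps)
  ultimately have "pairs_mod UNIV \<subseteq> ?K" unfolding pairs_mod_def by (rule fsc.kspan_minimal)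
  then show ?thesis using assms by blast
qed

text \<open>Under a character, \<open>bet_splits\<close> divides the value into a function of the
  boundary, which vanishes on cycles, and a trace form, which is the value of the composite
  map.\<close>

lemma from_to_HC:
  assumes "t \<in> pairs_mod L" "d1 t = 0" shows "t - from_HC (to_HC t) \<in> J1"
proof (rule fsc.mem_by_characters[OF J_subspace(1)])
  fix \<chi> :: "('r mat \<times> 'r mat \<Rightarrow> 'k) \<Rightarrow> rat_circle"
  assume chi: "additive \<chi>" "\<And>v. v \<in> J1 \<Longrightarrow> \<chi> v = 0"
  interpret F: lie_form sc e R0 R1 n u "\<lambda>X Y. \<chi> (tns X Y)" by (rule character_lie_form[OF chi])
  have tr: "\<chi> (fsc r (from_HC (trace_form tns X Y))) = trace_form F.gen (msc sc r X) Y" for r X Y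
    unfolding trace_form_def odd_form_def
    by (simp add: from_HC_sum from_HC_simps fsc.scale_sum_right fsc.scale_right_distrib
        additive.sum[OF chi(1)] additive.add[OF chi(1)] character_gen_free[OF chi] ssc_def)
  have zero': "0 \<in> finsup \<and> to_HC 0 \<in> finsup \<and> (\<forall>r. \<chi> (fsc r 0)
      = F.section_map (msc sc r (d1 0)) + \<chi> (fsc r (from_HC (to_HC 0))))"
    unfolding to_HC_simps from_HC_simps M.lin_ext_0 fsc.scale_zero_right M.scale_zero_right
      F.sec.zero additive.zero[OF chi(1)] by simp
  \<comment> \<open>A general scalar \<open>r\<close> is carried through the induction because the
    character does not commute with scalars.\<close>
  have "t \<in> finsup \<and> to_HC t \<in> finsup \<and> (\<forall>r. \<chi> (fsc r t)
      = F.section_map (msc sc r (d1 t)) + \<chi> (fsc r (from_HC (to_HC t))))"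
    using assms(1) unfolding pairs_mod_def
  proof induction
    case zero
    show ?case by (rule zero')
  next
    case (gen g)
    then obtain X Y where g: "g = tns X Y" "X \<in> L" "Y \<in> L" by blast
    then show ?case
      using F.bet_splits[of "msc sc r X" Y for r]
      by (simp add: to_HC_simps tr M.lin_ext_tns character_scale_tns_L[OF chi] br_msc)
  next
    case (add s t)
    then show ?case
      by (simp add: to_HC_simps from_HC_simps M.lin_ext_add M.scale_right_distrib fsc.scale_right_distrib
          additive.add[OF chi(1)] F.section_add algebra_simps del: plus_fun_apply)
  next
    case (smul t r)
    then show ?case by (simp add: to_HC_simps from_HC_simps M.lin_ext_fsc)
  qed
  then have "\<chi> (fsc 1 t) = F.section_map (msc sc 1 (d1 t)) + \<chi> (fsc 1 (from_HC (to_HC t)))" by blast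
  then show "\<chi> (t - from_HC (to_HC t)) = 0"
    using assms(2) by (simp add: additive.diff[OF chi(1)] F.sec.zero)
qed

lemma to_HC_pairs: assumes "t \<in> pairs_mod L" shows "to_HC t \<in> pairs_mod UNIV"
proof -
  have sub: "fsc.subspace (pairs_mod UNIV)" unfolding pairs_mod_def by (rule fsc.subspace_kspan)
  have tns: "tns a b \<in> pairs_mod UNIV" for a b :: 'r unfolding pairs_mod_def by (rule kspan.gen) blast
  have "trace_form tns X Y \<in> pairs_mod UNIV" for X Y
    unfolding trace_form_def odd_form_def by (intro fsc.subspace_sum[OF sub] fsc.subspace_add[OF sub] tns)
  then show ?thesis
    unfolding to_HC_def
    by (intro fsc.lin_ext_kspan[OF sub _ _ assms[unfolded pairs_mod_def]]) (auto simp: fsc.lin_ext_tns)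
qed

text \<open>Each term of the trace form pairs a coefficient of 1 with a coefficient of \<omega>, and
  the latter has shifted parity. This is the parity reversal in the theorem.\<close>

lemma to_HC_deg:
  assumes "t \<in> H2_deg sc R0 R1 n p" shows "to_HC t \<in> HC1_deg sc R0 R1 (\<not> p)"
proof -
  let ?D = "HC1_deg sc R0 R1 (\<not> p) :: ('r \<times> 'r \<Rightarrow> 'k) set"
  have sub: "fsc.subspace ?D" unfolding HC1_deg_def pairs_deg_def by (rule fsc.subspace_kspan)
  have tns: "tns a b \<in> ?D" if "rhom q a" "rhom r b" "p \<longleftrightarrow> q = r" for a b q r
    unfolding HC1_deg_def pairs_deg_def by (rule kspan.gen) (use that in blast)
  have "trace_form tns X Y \<in> ?D" if "X \<in> mhom q" "Y \<in> mhom r" "p = (q \<noteq> r)" for X Y q r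
    unfolding trace_form_def odd_form_def
  proof (intro fsc.subspace_sum[OF sub] fsc.subspace_add[OF sub])
    fix i j assume "i \<in> {..<n}" "j \<in> {..<n}"
    then have h: "shom q (ent X i j)" "shom r (ent Y j i)" using that by (auto intro: shom_ent)
    show "tns (fst (ent X i j)) (snd (ent Y j i)) \<in> ?D"
      by (rule tns[of q _ "\<not> r"]) (use h that in \<open>auto simp: shom_def\<close>)
    show "tns (snd (ent X i j)) (\<rho> (fst (ent Y j i))) \<in> ?D"
      by (rule tns[of "\<not> q" _ r]) (use h that in \<open>auto simp: shom_def rhom_rho\<close>)
  qed
  then have gen: "lin_ext fsc (trace_form tns) g \<in> ?D"
    if "g \<in> {tns X Y | X Y q r. X \<in> L \<and> Y \<in> L \<and> (X \<in> L \<and> X \<in> mhom q) \<and> (Y \<in> L \<and> Y \<in> mhom r) \<and> p = (q \<noteq> r)}" for g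
    using that by (elim CollectE exE conjE) (simp only: fsc.lin_ext_tns)
  show ?thesis
    unfolding to_HC_def
    by (rule fsc.lin_ext_kspan[OF sub _ gen assms[unfolded H2_deg_def pairs_deg_def hom_L]]) auto
qed

lemma H2_deg_finsup: "H2_deg sc R0 R1 n p \<subseteq> finsup"
  unfolding H2_deg_def pairs_deg_def by (rule fsc.kspan_minimal) (auto simp: subspace_finsup)

theorem H2_iso:
  "graded_iso_shift (H2_cycles sc R0 R1 n) J1 (H2_deg sc R0 R1 n) (HC1_cycles sc R0 R1) J2 (HC1_deg sc R0 R1)"
  unfolding graded_iso_shift_def
proof (intro exI[of _ to_HC] conjI ballI allI impI)
  have Z1: "x \<in> pairs_mod L" "d1 x = 0" "x \<in> finsup" if "x \<in> H2_cycles sc R0 R1 n" for x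
    using that pairs_mod_finsup by (auto simp: H2_cycles_def cycle_set_def)
  note J0 = fsc.subspace_0[OF J_subspace(2)]
  {
    fix x assume x: "x \<in> H2_cycles sc R0 R1 n"
    have "d2 (to_HC x) = 0"
      using d2_to_HC(1)[OF Z1(1)[OF x]] by (simp add: Z1(2)[OF x] odd_trace_def)
    then show "to_HC x \<in> HC1_cycles sc R0 R1"
      using to_HC_pairs[OF Z1(1)[OF x]] by (simp add: HC1_cycles_def cycle_set_def)
  next
    fix x y assume "x \<in> H2_cycles sc R0 R1 n" "y \<in> H2_cycles sc R0 R1 n"
    then show "to_HC (x + y) - to_HC x - to_HC y \<in> J2" using J0 Z1(3) by (simp add: to_HC_simps)
  next
    fix r x assume "x \<in> H2_cycles sc R0 R1 n"
    then show "to_HC (fsc r x) - fsc r (to_HC x) \<in> J2" using J0 Z1(3) by (simp add: to_HC_simps)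
  next
    fix x y assume xy: "x \<in> H2_cycles sc R0 R1 n" "y \<in> H2_cycles sc R0 R1 n"
    note fin = Z1(3)[OF xy(1)] Z1(3)[OF xy(2)]
    have diff: "x - y \<in> pairs_mod L" "d1 (x - y) = 0"
      using Z1[OF xy(1)] Z1[OF xy(2)] fsc.subspace_diff[OF fsc.subspace_kspan]
      by (auto simp: pairs_mod_def M.lin_ext_diff)
    show "to_HC x - to_HC y \<in> J2 \<longleftrightarrow> x - y \<in> J1"
    proof
      assume "to_HC x - to_HC y \<in> J2"
      then have "from_HC (to_HC (x - y)) \<in> J1" using from_HC_rels fin by (simp add: to_HC_simps)
      \<comment> \<open>x - y is its own difference from its round trip, in \<open>J1\<close>
        because it is a cycle, plus the round trip itself.\<close>
      from fsc.subspace_add[OF J_subspace(1) from_to_HC[OF diff] this] show "x - y \<in> J1" by simp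
    next
      assume "x - y \<in> J1"
      then show "to_HC x - to_HC y \<in> J2" using to_HC_rels[of "x - y"] fin by (simp add: to_HC_simps)
    qed
  next
    fix z :: "'r \<times> 'r \<Rightarrow> 'k" assume "z \<in> HC1_cycles sc R0 R1"
    then have z: "z \<in> pairs_mod UNIV" "d2 z = 0" by (auto simp: HC1_cycles_def cycle_set_def)
    have "from_HC z \<in> H2_cycles sc R0 R1 n"
      using from_HC_pairs[OF z(1)] z(2) elem_simps(1)[of 0 0]
      by (simp add: H2_cycles_def cycle_set_def zero_prod_def)
    then show "\<exists>x\<in>H2_cycles sc R0 R1 n. to_HC x - z \<in> J2" using to_from_HC[OF z(1)] by blast
  next
    fix p x assume x: "x \<in> H2_cycles sc R0 R1 n" and "\<exists>d\<in>H2_deg sc R0 R1 n p. x - d \<in> J1"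
    then obtain d where d: "d \<in> H2_deg sc R0 R1 n p" "x - d \<in> J1" by blast
    have "to_HC x - to_HC d \<in> J2"
      using to_HC_rels[OF d(2)] Z1(3)[OF x] d(1) H2_deg_finsup by (simp add: to_HC_simps subset_iff)
    then show "\<exists>d\<in>HC1_deg sc R0 R1 (\<not> p). to_HC x - d \<in> J2" using to_HC_deg[OF d(1)] by blast
  }
qed

end

theorem theorem4p1:
  fixes sc :: "'k::comm_ring_1 \<Rightarrow> 'r::ring \<Rightarrow> 'r" and e :: 'r
    and R0 R1 :: "'r set" and n :: nat
  assumes "superalgebra sc e R0 R1"
    and "\<exists>u::'k. 2 * u = 1"
    and "3 \<le> n"
  shows "graded_iso_shift (H2_cycles sc R0 R1 n) (H2_rels sc R0 R1 n) (H2_deg sc R0 R1 n)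
                          (HC1_cycles sc R0 R1) (HC1_rels sc R0 R1) (HC1_deg sc R0 R1)"
proof -
  obtain u :: 'k where "2 * u = 1" using assms(2) by blast
  then interpret queer sc e R0 R1 n u using assms by unfold_locales
  show ?thesis by (rule H2_iso)
qed

end
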